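(* Let $n \in \{3,4,\ldots,30\}\setminus\{15\}$. Then there is a one-to-one correspondence between $\mathcal{Q}(\mathfrak{S}_n)$ and the set of conjugacy classes of the group $\operatorname{Aut}(\mathfrak{S}_n)$, given by sending the conjugacy class of $\psi\in\operatorname{Aut}(\mathfrak{S}_n)$ to the quandle isomorphism class of $Q(\mathfrak{S}_n,\psi)$. In particular, for $n\in\{3,4,\ldots,30\}\setminus\{6,15\}$, there is a one-to-one correspondence between $\mathcal{Q}(\mathfrak{S}_n)$ and the set of conjugacy classes of $\mathfrak{S}_n$, given by sending the conjugacy class of $\pi\in\mathfrak{S}_n$ to the quandle isomorphism class of $Q(\mathfrak{S}_n,(\cdot)^{\pi})$.
   Context: A quandle is a set $Q$ with maps $s_x:Q\to Q$ ($x\in Q$) such that $s_x(x)=x$, each $s_x$ is a bijection, and $s_x\circ s_y=s_{s_x(y)}\circ s_x$ for all $x,y\in Q$. A quandle homomorphism $f:(Q,s)\to(Q',s')$ is a map with $f\circ s_x=s'_{f(x)}\circ f$ for all $x\in Q$; a bijective quandle homomorphism is a quandle isomorphism, and $Q\cong_Q Q'$ means that a quandle isomorphism exists. For a group $G$ and $\psi\in\operatorname{Aut}(G)$, the generalized Alexander quandle $Q(G,\psi)$ is the set $G$ with $s_g(h)=g\psi(g^{-1}h)$ for $g,h\in G$. For a finite group $G$, $\mathcal{Q}(G)=\{Q(G,\psi):\psi\in\operatorname{Aut}(G)\}/\cong_Q$ is the set of quandle isomorphism classes of the $Q(G,\psi)$. $\mathfrak{S}_n$ is the symmetric group on $\{1,\ldots,n\}$,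 and $(\cdot)^{\pi}$ denotes the inner automorphism $x\mapsto \pi x\pi^{-1}$. *)

theory Defs
  imports "HOL-Algebra.Sym_Groups" "HOL-Algebra.Group_Action"
begin

record 'a quandle_struct = "'a partial_object" +
  qop :: "'a \<Rightarrow> 'a \<Rightarrow> 'a"  (\<open>\<s>\<index>\<close>)

text \<open>The term \<open>\<s>\<^bsub>Q\<^esub> x y\<close> stands for $s_x(y)$ in the quandle \<open>Q\<close>.\<close>

locale quandle =
  fixes Q :: "('a, 'm) quandle_struct_scheme" (structure)
  assumes idem: "x \<in> carrier Q \<Longrightarrow> \<s> x x = x"
    and bij: "x \<in> carrier Q \<Longrightarrow> bij_betw (\<s> x) (carrier Q) (carrier Q)"
    and self_distrib: "\<lbrakk>x \<in> carrier Q; y \<in> carrier Q; z \<in> carrier Q\<rbrakk>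
      \<Longrightarrow> \<s> x (\<s> y z) = \<s> (\<s> x y) (\<s> x z)"

definition quandle_hom ::
  "('a, 'm) quandle_struct_scheme \<Rightarrow> ('b, 'n) quandle_struct_scheme \<Rightarrow> ('a \<Rightarrow> 'b) set"
  where "quandle_hom Q R = {f \<in> carrier Q \<rightarrow> carrier R.
    \<forall>x\<in>carrier Q. \<forall>y\<in>carrier Q. f (\<s>\<^bsub>Q\<^esub> x y) = \<s>\<^bsub>R\<^esub> (f x) (f y)}"

definition quandle_iso ::
  "('a, 'm) quandle_struct_scheme \<Rightarrow> ('b, 'n) quandle_struct_scheme \<Rightarrow> ('a \<Rightarrow> 'b) set"
  where "quandle_iso Q R = {f \<in> quandle_hom Q R. bij_betw f (carrier Q) (carrier R)}"

definition is_quandle_iso ::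
  "('a, 'm) quandle_struct_scheme \<Rightarrow> ('b, 'n) quandle_struct_scheme \<Rightarrow> bool"
  (infix \<open>\<cong>\<^sub>Q\<close> 60)
  where "Q \<cong>\<^sub>Q R \<longleftrightarrow> quandle_iso Q R \<noteq> {}"

text \<open>The operation is made extensional, so that equality of the records is equality of
  the quandles.\<close>

definition gen_alexander :: "('a, 'm) monoid_scheme \<Rightarrow> ('a \<Rightarrow> 'a) \<Rightarrow> 'a quandle_struct"
  where "gen_alexander G \<psi> = \<lparr>carrier = carrier G,
    qop = (\<lambda>g\<in>carrier G. \<lambda>h\<in>carrier G. g \<otimes>\<^bsub>G\<^esub> \<psi> (inv\<^bsub>G\<^esub> g \<otimes>\<^bsub>G\<^esub> h))\<rparr>"

definition gen_alexanders :: "('a, 'm) monoid_scheme \<Rightarrow> 'a quandle_struct set"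
  where "gen_alexanders G = gen_alexander G ` carrier (AutoGroup G)"

definition gen_alexander_iso_rel :: "('a, 'm) monoid_scheme \<Rightarrow> 'a quandle_struct rel"
  where "gen_alexander_iso_rel G =
    {(Q, R). Q \<in> gen_alexanders G \<and> R \<in> gen_alexanders G \<and> Q \<cong>\<^sub>Q R}"

definition gen_alexander_classes :: "('a, 'm) monoid_scheme \<Rightarrow> 'a quandle_struct set set"
  where "gen_alexander_classes G = gen_alexanders G // gen_alexander_iso_rel G"

definition gen_alexander_class ::
  "('a, 'm) monoid_scheme \<Rightarrow> ('a \<Rightarrow> 'a) \<Rightarrow> 'a quandle_struct set"
  where "gen_alexander_class G \<psi> = gen_alexander_iso_rel G `` {gen_alexander G \<psi>}"

definition conj_by :: "('a, 'm) monoid_scheme \<Rightarrow> 'a \<Rightarrow> 'a \<Rightarrow> 'a"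
  where "conj_by G g = (\<lambda>h\<in>carrier G. g \<otimes>\<^bsub>G\<^esub> h \<otimes>\<^bsub>G\<^esub> inv\<^bsub>G\<^esub> g)"

definition conj_class :: "('a, 'm) monoid_scheme \<Rightarrow> 'a \<Rightarrow> 'a set"
  where "conj_class G x = orbit G (conj_by G) x"

definition conj_classes :: "('a, 'm) monoid_scheme \<Rightarrow> 'a set set"
  where "conj_classes G = orbits G (carrier G) (conj_by G)"

lemma auto_group_carrier: "carrier (AutoGroup G) = auto G"
  by (simp add: AutoGroup_def)

lemma conj_classes_eq: "conj_classes G = conj_class G ` carrier G"
  by (auto simp: conj_classes_def conj_class_def orbits_def)

lemma (in group) conj_class_eq:
  assumes "x \<in> carrier G"
  shows "conj_class G x = {g \<otimes> x \<otimes> inv g | g. g \<in> carrier G}"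
  using assms by (auto simp: conj_class_def orbit_def conj_by_def)

lemma gen_alexander_simps:
  "carrier (gen_alexander G \<psi>) = carrier G"
  "\<lbrakk>g \<in> carrier G; h \<in> carrier G\<rbrakk>
    \<Longrightarrow> \<s>\<^bsub>gen_alexander G \<psi>\<^esub> g h = g \<otimes>\<^bsub>G\<^esub> \<psi> (inv\<^bsub>G\<^esub> g \<otimes>\<^bsub>G\<^esub> h)"
  by (simp_all add: gen_alexander_def)

lemma (in group) quandle_gen_alexander:
  assumes "\<psi> \<in> carrier (AutoGroup G)"
  shows "quandle (gen_alexander G \<psi>)"
proof -
  have hom: "\<psi> \<in> hom G G" and bij: "bij_betw \<psi> (carrier G) (carrier G)"
    using assms by (auto simp: auto_group_carrier auto_def Bij_def)
  interpret \<psi>: group_hom G G \<psi>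
    using hom by (simp add: group_hom_def group_hom_axioms_def is_group)
  show ?thesis
  proof
    fix x assume "x \<in> carrier (gen_alexander G \<psi>)"
    then have x: "x \<in> carrier G" by (simp add: gen_alexander_simps)
    show "\<s>\<^bsub>gen_alexander G \<psi>\<^esub> x x = x"
      using x by (simp add: gen_alexander_simps)
    have l: "bij_betw (\<lambda>h. y \<otimes> h) (carrier G) (carrier G)" if y: "y \<in> carrier G" for y
    proof (rule bij_betwI[where g = "\<lambda>h. inv y \<otimes> h"])
      show "inv y \<otimes> (y \<otimes> h) = h" if "h \<in> carrier G" for h
        using that y by (simp flip: m_assoc)
      show "y \<otimes> (inv y \<otimes> h) = h" if "h \<in> carrier G" for h
        using that y by (simp flip: m_assoc)
    qed (use y in auto)
    have "bij_betw ((\<lambda>h. x \<otimes> h) \<circ> (\<psi> \<circ> (\<lambda>h. inv x \<otimes> h))) (carrier G) (carrier G)"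
      using l[OF x] l[OF inv_closed[OF x]] bij by (blast intro: bij_betw_trans)
    then show "bij_betw (\<s>\<^bsub>gen_alexander G \<psi>\<^esub> x)
        (carrier (gen_alexander G \<psi>)) (carrier (gen_alexander G \<psi>))"
      using x by (subst bij_betw_cong[of _ _ "(\<lambda>h. x \<otimes> h) \<circ> (\<psi> \<circ> (\<lambda>h. inv x \<otimes> h))"])
        (simp_all add: gen_alexander_simps)
  next
    fix x y z
    assume "x \<in> carrier (gen_alexander G \<psi>)" "y \<in> carrier (gen_alexander G \<psi>)"
      "z \<in> carrier (gen_alexander G \<psi>)"
    then have *: "x \<in> carrier G" "y \<in> carrier G" "z \<in> carrier G"
      by (simp_all add: gen_alexander_simps)
    have "inv (x \<otimes> \<psi> (inv x \<otimes> y)) \<otimes> (x \<otimes> \<psi> (inv x \<otimes> z)) = \<psi> (inv y \<otimes> z)"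
      using * by (simp add: inv_mult_group m_assoc) (simp add: inv_solve_left flip: m_assoc)
    then show "\<s>\<^bsub>gen_alexander G \<psi>\<^esub> x (\<s>\<^bsub>gen_alexander G \<psi>\<^esub> y z) =
        \<s>\<^bsub>gen_alexander G \<psi>\<^esub> (\<s>\<^bsub>gen_alexander G \<psi>\<^esub> x y) (\<s>\<^bsub>gen_alexander G \<psi>\<^esub> x z)"
      using * by (simp add: gen_alexander_simps m_assoc)
  qed
qed

lemma is_quandle_iso_refl: "Q \<cong>\<^sub>Q Q"
proof -
  have "id \<in> quandle_iso Q Q"
    by (simp add: quandle_iso_def quandle_hom_def)
  then show ?thesis by (auto simp: is_quandle_iso_def)
qed

lemma is_quandle_iso_trans:
  assumes "P \<cong>\<^sub>Q Q" "Q \<cong>\<^sub>Q R"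
  shows "P \<cong>\<^sub>Q R"
proof -
  from assms obtain f g where "f \<in> quandle_iso P Q" "g \<in> quandle_iso Q R"
    by (auto simp: is_quandle_iso_def)
  then have "g \<circ> f \<in> quandle_iso P R"
    by (auto simp: quandle_iso_def quandle_hom_def Pi_iff intro: bij_betw_trans)
  then show ?thesis by (auto simp: is_quandle_iso_def)
qed

lemma is_quandle_iso_sym:
  assumes "quandle Q" "Q \<cong>\<^sub>Q R"
  shows "R \<cong>\<^sub>Q Q"
proof -
  from assms(2) obtain f where hom: "f \<in> quandle_hom Q R"
    and bij: "bij_betw f (carrier Q) (carrier R)"
    by (auto simp: is_quandle_iso_def quandle_iso_def)
  let ?g = "inv_into (carrier Q) f"
  have g: "?g x \<in> carrier Q" "f (?g x) = x" if "x \<in> carrier R" for x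
    using that bij by (auto simp: bij_betw_def inv_into_into f_inv_into_f)
  have "?g (\<s>\<^bsub>R\<^esub> x y) = \<s>\<^bsub>Q\<^esub> (?g x) (?g y)" if "x \<in> carrier R" "y \<in> carrier R" for x y
  proof -
    have "\<s>\<^bsub>Q\<^esub> (?g x) (?g y) \<in> carrier Q"
      using quandle.bij[OF assms(1) g(1)[OF that(1)]] g(1)[OF that(2)]
      by (auto dest: bij_betwE)
    moreover have "f (\<s>\<^bsub>Q\<^esub> (?g x) (?g y)) = \<s>\<^bsub>R\<^esub> x y"
      using hom that g by (simp add: quandle_hom_def)
    ultimately show ?thesis
      using bij by (metis bij_betw_inv_into_left)
  qed
  then have "?g \<in> quandle_iso R Q"
    using bij g by (simp add: quandle_iso_def quandle_hom_def bij_betw_inv_into)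
  then show ?thesis by (auto simp: is_quandle_iso_def)
qed

lemma (in group) equiv_gen_alexander_iso_rel:
  "equiv (gen_alexanders G) (gen_alexander_iso_rel G)"
  unfolding gen_alexander_iso_rel_def
  by (intro equivI refl_onI symI transI)
    (auto simp: gen_alexanders_def intro: is_quandle_iso_refl is_quandle_iso_sym
      is_quandle_iso_trans quandle_gen_alexander)

end

(*
  A quandle isomorphism f from Q(G, psi) to Q(G, phi) may be taken to fix 1. Then f psi = phi f, and
  f(d x) = f(d) f(x) for every d in the displacement group, the normal subgroup generated by the
  elements g psi(g)^-1.

  Let G = S_n with n >= 5 and psi not the identity. Automorphisms preserve parity, so the
  displacement group contains A_n and f restricts to an automorphism of A_n. Every automorphism of
  A_n extends to S_n: those that preserve three-cycles are conjugations by elements of S_n, and an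
  arbitrary one transports the conjugations by elements of S_n to automorphisms that preserve
  three-cycles. The extension of f conjugates psi to phi, because automorphisms of S_n that agree on
  A_n are equal.

  For n = 3 and n = 4 all automorphisms are inner, and the conjugacy class of p is determined by the
  order of p and by whether all commutators with p square to the identity; both are visible in
  Q(S_n, (.)^p).

  For n different from 6 every automorphism of S_n is inner: the product of any two transpositions
  has order dividing 6, and among the odd involutions only transpositions share this property with
  all their conjugates.
*)

theory Submission
  imports Defs
begin

section \<open>Generalized Alexander quandles of a group\<close>

text \<open>In Q(G, psi) the map s_1 is psi, and s_g(h) = (g psi(g)^-1) psi(h), so s_g after the
  inverse of s_1 is left translation by the displacement g psi(g)^-1. A pointed isomorphism f
  carries these translations to translations of the same kind; off the displacement group it need
  not be multiplicative. Hence f itself cannot serve as the conjugating automorphism, and one is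
  rebuilt from the restriction of f to A_n. The detour through transported conjugations is forced by
  n = 6, where an automorphism of A_n may send three-cycles to products of two disjoint
  three-cycles. It gives the extension uniformly, so the outer automorphisms of S_6 never have to be
  classified. The cases n = 3 and n = 4 resist this argument: in S_4 the displacement group can be
  the Klein four-group, and the action on the abelian group A_3 does not determine an automorphism
  of S_3.\<close>

lemma bij_betw_factor:
  assumes "\<And>x y. x \<in> X \<Longrightarrow> y \<in> X \<Longrightarrow> c x = c y \<longleftrightarrow> k x = k y"
  shows "\<exists>F. (\<forall>x\<in>X. F (c x) = k x) \<and> bij_betw F (c ` X) (k ` X)"
proof -
  \<comment> \<open>Any representative will do: read from left to right the hypothesis makes the
    value independent of the choice, read from right to left it makes \<open>F\<close>
    injective.\<close>
  define F where "F = (\<lambda>C. k (inv_into X c C))"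
  have F: "F (c x) = k x" if "x \<in> X" for x
    using that assms[of "inv_into X c (c x)" x]
    by (simp add: F_def f_inv_into_f inv_into_into)
  moreover have "bij_betw F (c ` X) (k ` X)"
    using F assms by (auto simp: bij_betw_def inj_on_def image_image)
  ultimately show ?thesis by blast
qed

context group
begin

lemma auto_bij_betw: "\<psi> \<in> auto G \<Longrightarrow> bij_betw \<psi> (carrier G) (carrier G)"
  by (simp add: auto_def Bij_def)

lemma auto_group_hom: "\<psi> \<in> auto G \<Longrightarrow> group_hom G G \<psi>"
  by (simp add: auto_def group_hom_def group_hom_axioms_def is_group)

lemma auto_closed: "\<psi> \<in> auto G \<Longrightarrow> x \<in> carrier G \<Longrightarrow> \<psi> x \<in> carrier G"
  using group_hom.hom_closed[OF auto_group_hom] .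

lemma auto_mult: "\<psi> \<in> auto G \<Longrightarrow> x \<in> carrier G \<Longrightarrow> y \<in> carrier G \<Longrightarrow> \<psi> (x \<otimes> y) = \<psi> x \<otimes> \<psi> y"
  using group_hom.hom_mult[OF auto_group_hom] .

lemma auto_inv: "\<psi> \<in> auto G \<Longrightarrow> x \<in> carrier G \<Longrightarrow> \<psi> (inv x) = inv \<psi> x"
  using group_hom.hom_inv[OF auto_group_hom] .

lemma auto_inj: "\<psi> \<in> auto G \<Longrightarrow> x \<in> carrier G \<Longrightarrow> y \<in> carrier G \<Longrightarrow> \<psi> x = \<psi> y \<longleftrightarrow> x = y"
  using auto_bij_betw by (metis bij_betw_def inj_onD)

text \<open>Members of \<open>auto\<close> are extensional, so they take the same default value off
  the carrier.\<close>

lemma auto_eqI: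
  assumes "\<psi> \<in> auto G" "\<phi> \<in> auto G" "\<And>x. x \<in> carrier G \<Longrightarrow> \<psi> x = \<phi> x"
  shows "\<psi> = \<phi>"
  using assms by (auto simp: auto_def Bij_def intro: extensionalityI)

lemma autoI:
  assumes "\<And>x. x \<in> carrier G \<Longrightarrow> f x \<in> carrier G" "inj_on f (carrier G)"
    "\<And>x y. x \<in> carrier G \<Longrightarrow> y \<in> carrier G \<Longrightarrow> f (x \<otimes> y) = f x \<otimes> f y"
    "carrier G \<subseteq> f ` carrier G"
  shows "restrict f (carrier G) \<in> auto G"
  using assms by (auto simp: auto_def Bij_def hom_def bij_betw_def)

lemma AutoGroup_mult:
  assumes "\<psi> \<in> auto G" "\<phi> \<in> auto G"
  shows "\<psi> \<otimes>\<^bsub>AutoGroup G\<^esub> \<phi> = compose (carrier G) \<psi> \<phi>"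
  using assms by (simp add: AutoGroup_def BijGroup_def auto_def)

section \<open>Conjugacy classes and isomorphism classes\<close>

lemma conj_class_mono:
  assumes x: "x \<in> carrier G" and y: "y \<in> carrier G" and g: "g \<in> carrier G" "g \<otimes> x = y \<otimes> g"
  shows "conj_class G x \<subseteq> conj_class G y"
proof
  fix z assume "z \<in> conj_class G x"
  then obtain h where h: "h \<in> carrier G" "z = h \<otimes> x \<otimes> inv h"
    using x by (auto simp: conj_class_eq)
  have "x = inv g \<otimes> y \<otimes> g"
    using g x y by (simp add: m_assoc flip: g(2)) (simp flip: m_assoc)
  then have "z = (h \<otimes> inv g) \<otimes> y \<otimes> inv (h \<otimes> inv g)"
    using g y h by (simp add: inv_mult_group m_assoc)
  then show "z \<in> conj_class G y"
    using y g h by (auto simp: conj_class_eq)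
qed

lemma conj_class_eq_iff:
  assumes x: "x \<in> carrier G" and y: "y \<in> carrier G"
  shows "conj_class G x = conj_class G y \<longleftrightarrow> (\<exists>g\<in>carrier G. g \<otimes> x = y \<otimes> g)"
proof
  assume "conj_class G x = conj_class G y"
  moreover have "y \<in> conj_class G y"
    using y by (auto simp: conj_class_eq intro!: exI[of _ \<one>])
  ultimately obtain g where "g \<in> carrier G" "y = g \<otimes> x \<otimes> inv g"
    using x by (auto simp: conj_class_eq)
  then show "\<exists>g\<in>carrier G. g \<otimes> x = y \<otimes> g"
    using x by (intro bexI[of _ g]) (simp_all add: m_assoc)
next
  assume "\<exists>g\<in>carrier G. g \<otimes> x = y \<otimes> g"
  then obtain g where g: "g \<in> carrier G" "g \<otimes> x = y \<otimes> g" by blast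
  then have "inv g \<otimes> y = x \<otimes> inv g"
    using x y by (metis inv_closed inv_solve_left inv_solve_right m_assoc m_closed)
  then show "conj_class G x = conj_class G y"
    using g x y conj_class_mono[of x y g] conj_class_mono[of y x "inv g"] by auto
qed

text \<open>Conjugacy in \<open>AutoGroup G\<close>, written pointwise and as an intertwining
  relation so that no inverse in \<open>AutoGroup G\<close> has to be computed.\<close>

definition auto_conjugate :: "('a \<Rightarrow> 'a) \<Rightarrow> ('a \<Rightarrow> 'a) \<Rightarrow> bool"
  where "auto_conjugate \<psi> \<phi> \<longleftrightarrow> (\<exists>\<tau>\<in>auto G. \<forall>x\<in>carrier G. \<tau> (\<psi> x) = \<phi> (\<tau> x))"

lemma conj_class_AutoGroup_eq_iff:
  assumes "\<psi> \<in> auto G" "\<phi> \<in> auto G"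
  shows "conj_class (AutoGroup G) \<psi> = conj_class (AutoGroup G) \<phi> \<longleftrightarrow> auto_conjugate \<psi> \<phi>"
proof -
  interpret Aut: group "AutoGroup G" by (rule AutoGroup)
  have "\<tau> \<otimes>\<^bsub>AutoGroup G\<^esub> \<psi> = \<phi> \<otimes>\<^bsub>AutoGroup G\<^esub> \<tau> \<longleftrightarrow> (\<forall>x\<in>carrier G. \<tau> (\<psi> x) = \<phi> (\<tau> x))"
    if "\<tau> \<in> auto G" for \<tau>
    using that assms
    by (auto simp: AutoGroup_mult fun_eq_iff compose_def restrict_def)
  then show ?thesis
    using Aut.conj_class_eq_iff[of \<psi> \<phi>] assms
    by (simp add: auto_group_carrier auto_conjugate_def)
qed

lemma gen_alexander_class_eq_iff:
  assumes "\<psi> \<in> auto G" "\<phi> \<in> auto G"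
  shows "gen_alexander_class G \<psi> = gen_alexander_class G \<phi>
    \<longleftrightarrow> gen_alexander G \<psi> \<cong>\<^sub>Q gen_alexander G \<phi>"
proof -
  have "gen_alexander G \<psi> \<in> gen_alexanders G" "gen_alexander G \<phi> \<in> gen_alexanders G"
    using assms by (auto simp: gen_alexanders_def auto_group_carrier)
  then show ?thesis
    using eq_equiv_class_iff[OF equiv_gen_alexander_iso_rel]
    by (auto simp: gen_alexander_class_def gen_alexander_iso_rel_def)
qed

lemma gen_alexander_classes_eq: "gen_alexander_classes G = gen_alexander_class G ` auto G"
  by (auto simp: gen_alexander_classes_def gen_alexander_class_def quotient_def gen_alexanders_def
      auto_group_carrier)

text \<open>The direction that holds in every group: the intertwining automorphism is itself a
  quandle isomorphism.\<close>

lemma gen_alexander_iso_of_conjugate: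
  assumes "\<psi> \<in> auto G" "\<phi> \<in> auto G" "auto_conjugate \<psi> \<phi>"
  shows "gen_alexander G \<psi> \<cong>\<^sub>Q gen_alexander G \<phi>"
proof -
  obtain \<tau> where \<tau>: "\<tau> \<in> auto G" "\<And>x. x \<in> carrier G \<Longrightarrow> \<tau> (\<psi> x) = \<phi> (\<tau> x)"
    using assms(3) by (auto simp: auto_conjugate_def)
  have "\<tau> \<in> quandle_iso (gen_alexander G \<psi>) (gen_alexander G \<phi>)"
    using \<tau> auto_bij_betw[OF \<tau>(1)] assms
    by (simp add: quandle_iso_def quandle_hom_def gen_alexander_simps auto_mult auto_inv auto_closed)
  then show ?thesis by (auto simp: is_quandle_iso_def)
qed

text \<open>Translating by the inverse of the image of the identity turns a quandle isomorphism into one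
  that fixes the identity.\<close>

lemma gen_alexander_iso_pointed:
  assumes \<psi>: "\<psi> \<in> auto G" and \<phi>: "\<phi> \<in> auto G"
    and iso: "gen_alexander G \<psi> \<cong>\<^sub>Q gen_alexander G \<phi>"
  obtains f where "bij_betw f (carrier G) (carrier G)" "f \<one> = \<one>"
    "\<And>g h. g \<in> carrier G \<Longrightarrow> h \<in> carrier G \<Longrightarrow>
      f (g \<otimes> \<psi> (inv g \<otimes> h)) = f g \<otimes> \<phi> (inv f g \<otimes> f h)"
proof -
  obtain e where e: "bij_betw e (carrier G) (carrier G)"
    "\<And>g h. g \<in> carrier G \<Longrightarrow> h \<in> carrier G \<Longrightarrow>
      e (g \<otimes> \<psi> (inv g \<otimes> h)) = e g \<otimes> \<phi> (inv e g \<otimes> e h)"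
  proof -
    obtain e where "e \<in> quandle_iso (gen_alexander G \<psi>) (gen_alexander G \<phi>)"
      using iso by (auto simp: is_quandle_iso_def)
    then have "bij_betw e (carrier G) (carrier G)" "e \<in> carrier G \<rightarrow> carrier G"
      "\<forall>g\<in>carrier G. \<forall>h\<in>carrier G. e (g \<otimes> \<psi> (inv g \<otimes> h)) = e g \<otimes> \<phi> (inv e g \<otimes> e h)"
      by (auto simp: quandle_iso_def quandle_hom_def gen_alexander_simps Pi_iff)
    then show thesis using that by blast
  qed
  have ecl: "e x \<in> carrier G" if "x \<in> carrier G" for x
    using e(1) that by (auto dest: bij_betwE)
  define f where "f = (\<lambda>x. inv e \<one> \<otimes> e x)"
  have "bij_betw (\<lambda>y. inv e \<one> \<otimes> y) (carrier G) (carrier G)"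
    by (rule bij_betwI[where g = "\<lambda>y. e \<one> \<otimes> y"]) (auto simp: ecl simp flip: m_assoc)
  then have "bij_betw f (carrier G) (carrier G)"
    using bij_betw_trans[OF e(1)] by (simp add: f_def o_def)
  moreover have "f \<one> = \<one>" using ecl by (simp add: f_def)
  moreover have "f (g \<otimes> \<psi> (inv g \<otimes> h)) = f g \<otimes> \<phi> (inv f g \<otimes> f h)"
    if "g \<in> carrier G" "h \<in> carrier G" for g h
  proof -
    \<comment> \<open>The quandle operation is the left factor times a function of the quotient g^-1
      h, and a left translation leaves this quotient unchanged; so left translations are quandle
      automorphisms.\<close>
    have "inv f g \<otimes> f h = inv e g \<otimes> e h"
      using that ecl by (simp add: f_def inv_mult_group m_assoc) (simp flip: m_assoc)
    then show ?thesis
      using that ecl e(2)[OF that] \<phi> by (simp add: f_def auto_closed m_assoc)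
  qed
  ultimately show thesis using that by blast
qed

text \<open>The generators are the quotients $s_g(h) h^{-1}$, which are products of displacements
  $g\psi(g)^{-1}$ and their inverses. Unlike the displacements, they are closed under conjugation.\<close>

definition displacement_group :: "('a \<Rightarrow> 'a) \<Rightarrow> 'a set"
  where "displacement_group \<psi> =
    generate G {g \<otimes> \<psi> (inv g \<otimes> h) \<otimes> inv h | g h. g \<in> carrier G \<and> h \<in> carrier G}"

text \<open>Conjugation by x turns the generator for (g, h) into the generator for (x g, x h), since
  both pairs have the same quotient g^-1 h.\<close>

lemma normal_displacement_group:
  assumes \<psi>: "\<psi> \<in> auto G"
  shows "displacement_group \<psi> \<lhd> G"
  unfolding displacement_group_def
proof (rule normal_generateI)
  show "{g \<otimes> \<psi> (inv g \<otimes> h) \<otimes> inv h | g h. g \<in> carrier G \<and> h \<in> carrier G} \<subseteq> carrier G"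
    by (auto simp: auto_closed \<psi>)
next
  fix d x assume "d \<in> {g \<otimes> \<psi> (inv g \<otimes> h) \<otimes> inv h | g h. g \<in> carrier G \<and> h \<in> carrier G}"
    and x: "x \<in> carrier G"
  then obtain g h where d: "d = g \<otimes> \<psi> (inv g \<otimes> h) \<otimes> inv h" and gh: "g \<in> carrier G" "h \<in> carrier G"
    by auto
  have "inv (x \<otimes> g) \<otimes> (x \<otimes> h) = inv g \<otimes> h"
    using x gh by (simp add: inv_mult_group m_assoc) (simp flip: m_assoc)
  then have "x \<otimes> d \<otimes> inv x = (x \<otimes> g) \<otimes> \<psi> (inv (x \<otimes> g) \<otimes> (x \<otimes> h)) \<otimes> inv (x \<otimes> h)"
    using x gh by (simp add: d auto_closed \<psi> inv_mult_group m_assoc)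
  then show "x \<otimes> d \<otimes> inv x
      \<in> {g \<otimes> \<psi> (inv g \<otimes> h) \<otimes> inv h | g h. g \<in> carrier G \<and> h \<in> carrier G}"
    using x gh by blast
qed

lemma displacement_mem:
  assumes \<psi>: "\<psi> \<in> auto G" and g: "g \<in> carrier G"
  shows "g \<otimes> inv \<psi> g \<in> displacement_group \<psi>"
proof -
  have "g \<otimes> \<psi> (inv g \<otimes> \<one>) \<otimes> inv \<one> \<in> displacement_group \<psi>"
    unfolding displacement_group_def using g by (intro generate.incl) blast
  then show ?thesis using g by (simp add: auto_inv[OF \<psi>] auto_closed[OF \<psi>])
qed

end

section \<open>Quandle isomorphisms that fix the identity\<close>

locale pointed_alexander_iso = group +
  fixes \<psi> \<phi> f
  assumes \<psi>: "\<psi> \<in> auto G" and \<phi>: "\<phi> \<in> auto G"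
    and bij: "bij_betw f (carrier G) (carrier G)"
    and f_one: "f \<one> = \<one>"
    and f_op: "\<And>g h. g \<in> carrier G \<Longrightarrow> h \<in> carrier G \<Longrightarrow>
      f (g \<otimes> \<psi> (inv g \<otimes> h)) = f g \<otimes> \<phi> (inv f g \<otimes> f h)"
begin

lemma f_closed [simp]: "x \<in> carrier G \<Longrightarrow> f x \<in> carrier G"
  using bij by (auto dest: bij_betwE)

lemma auto_closed' [simp]:
  "x \<in> carrier G \<Longrightarrow> \<psi> x \<in> carrier G" "x \<in> carrier G \<Longrightarrow> \<phi> x \<in> carrier G"
  using auto_closed \<psi> \<phi> by blast+

lemma f_intertwines: "x \<in> carrier G \<Longrightarrow> f (\<psi> x) = \<phi> (f x)"
  using f_op[of \<one> x] f_one by simp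

lemma f_displacement: "g \<in> carrier G \<Longrightarrow> f (g \<otimes> inv \<psi> g) = f g \<otimes> inv \<phi> (f g)"
  using f_op[of g \<one>] f_one by (simp add: auto_inv \<psi> \<phi>)

text \<open>The largest set on which f respects left multiplication. Quantifying over all x in the
  group, and not only over the set itself, is what makes it a subgroup although f is no
  homomorphism.\<close>

definition mult_part :: "'a set"
  where "mult_part = {k \<in> carrier G. \<forall>x\<in>carrier G. f (k \<otimes> x) = f k \<otimes> f x}"

text \<open>Since \<psi> is onto, x = \<psi> h for some h, and then the displacement of g times x is
  s_g(h). The quandle law for f at (g, h) is the claim.\<close>

lemma displacement_mult_part:
  assumes g: "g \<in> carrier G"
  shows "g \<otimes> inv \<psi> g \<in> mult_part"
proof -
  have "f (g \<otimes> inv \<psi> g \<otimes> x) = f (g \<otimes> inv \<psi> g) \<otimes> f x" if x: "x \<in> carrier G" for x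
  proof -
    obtain h where h: "h \<in> carrier G" "x = \<psi> h"
      using auto_bij_betw[OF \<psi>] x by (auto simp: bij_betw_def)
    show ?thesis
      using f_op[OF g h(1)] g h f_displacement f_intertwines
      by (simp add: auto_mult auto_inv \<psi> \<phi> m_assoc)
  qed
  then show ?thesis using g by (simp add: mult_part_def)
qed

lemma subgroup_mult_part: "subgroup mult_part G"
proof (rule subgroupI)
  show "mult_part \<noteq> {}" using displacement_mult_part[of \<one>] by blast
  show "inv k \<in> mult_part" if "k \<in> mult_part" for k
  proof -
    have k: "k \<in> carrier G" "\<And>x. x \<in> carrier G \<Longrightarrow> f (k \<otimes> x) = f k \<otimes> f x"
      using that by (auto simp: mult_part_def)
    have "f (inv k \<otimes> x) = inv f k \<otimes> f x" if "x \<in> carrier G" for x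
      using k(2)[of "inv k \<otimes> x"] k(1) that by (simp flip: m_assoc add: inv_solve_left)
    then show ?thesis
      using k(1) f_one by (simp add: mult_part_def) (metis inv_closed one_closed r_one f_closed)
  qed
qed (auto simp: mult_part_def m_assoc)

text \<open>Ties the conjugation-closed generators of \<open>displacement_group\<close> to the
  displacements: each generator is a displacement times the inverse of another.\<close>

lemma displacement_quotient:
  "g \<in> carrier G \<Longrightarrow> h \<in> carrier G \<Longrightarrow>
    g \<otimes> \<psi> (inv g \<otimes> h) \<otimes> inv h = g \<otimes> inv \<psi> g \<otimes> inv (h \<otimes> inv \<psi> h)"
  by (simp add: auto_mult auto_inv \<psi> inv_mult_group m_assoc)

lemma displacement_group_subset:
  assumes "subgroup K G" "\<And>g. g \<in> carrier G \<Longrightarrow> g \<otimes> inv \<psi> g \<in> K"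
  shows "displacement_group \<psi> \<subseteq> K"
  unfolding displacement_group_def
  by (rule generate_subgroup_incl[OF _ assms(1)])
    (auto simp: displacement_quotient assms subgroup.m_closed subgroup.m_inv_closed)

lemma displacement_group_mult_part: "displacement_group \<psi> \<subseteq> mult_part"
  using displacement_group_subset[OF subgroup_mult_part] displacement_mult_part by blast

text \<open>The part of \<open>mult_part\<close> that f maps into N is a subgroup, and it contains
  every displacement of \<psi> because f maps it to a displacement of \<phi>. Confines the image to
  the alternating group later.\<close>

lemma image_displacement_group:
  assumes "subgroup N G" "\<And>g. g \<in> carrier G \<Longrightarrow> g \<otimes> inv \<phi> g \<in> N"
  shows "f ` displacement_group \<psi> \<subseteq> N"
proof -
  interpret N: subgroup N G by fact
  have "subgroup {k \<in> mult_part. f k \<in> N} G"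
  proof (rule subgroupI)
    show "{k \<in> mult_part. f k \<in> N} \<noteq> {}"
      using subgroup.one_closed[OF subgroup_mult_part] f_one by auto
    show "{k \<in> mult_part. f k \<in> N} \<subseteq> carrier G" by (auto simp: mult_part_def)
  next
    fix k assume k: "k \<in> {k \<in> mult_part. f k \<in> N}"
    then have kc: "k \<in> carrier G" by (simp add: mult_part_def)
    have "f (k \<otimes> inv k) = f k \<otimes> f (inv k)"
      using k kc unfolding mult_part_def by blast
    then have "f k \<otimes> f (inv k) = \<one>"
      using kc f_one by simp
    then have "f (inv k) = inv f k" 
      using kc by (metis f_closed inv_closed inv_inv inv_equality)
    then show "inv k \<in> {k \<in> mult_part. f k \<in> N}"
      using k subgroup.m_inv_closed[OF subgroup_mult_part] by simp
  next
    fix k l assume kl: "k \<in> {k \<in> mult_part. f k \<in> N}" "l \<in> {k \<in> mult_part. f k \<in> N}"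
    then have "f (k \<otimes> l) = f k \<otimes> f l" by (auto simp: mult_part_def)
    then show "k \<otimes> l \<in> {k \<in> mult_part. f k \<in> N}"
      using kl subgroup.m_closed[OF subgroup_mult_part] by simp
  qed
  then have "displacement_group \<psi> \<subseteq> {k \<in> mult_part. f k \<in> N}"
    by (rule displacement_group_subset)
      (use displacement_mult_part f_displacement assms(2) in auto)
  then show ?thesis by auto
qed

end

section \<open>Correspondences from the conjugacy of automorphisms\<close>

context group
begin

text \<open>The converse of the hypothesis is true in every group, so the hypothesis is all that
  remains to be shown for the symmetric groups.\<close>

theorem AutoGroup_correspondence:
  assumes "\<And>\<psi> \<phi>. \<psi> \<in> auto G \<Longrightarrow> \<phi> \<in> auto G \<Longrightarrow>
    gen_alexander G \<psi> \<cong>\<^sub>Q gen_alexander G \<phi> \<Longrightarrow> auto_conjugate \<psi> \<phi>"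
  shows "\<exists>F. (\<forall>\<psi>\<in>carrier (AutoGroup G).
      F (conj_class (AutoGroup G) \<psi>) = gen_alexander_class G \<psi>) \<and>
    bij_betw F (conj_classes (AutoGroup G)) (gen_alexander_classes G)"
  unfolding auto_group_carrier conj_classes_eq gen_alexander_classes_eq
  by (rule bij_betw_factor)
    (use assms gen_alexander_iso_of_conjugate in
      \<open>auto simp: conj_class_AutoGroup_eq_iff gen_alexander_class_eq_iff\<close>)

lemma conj_by_simp: "x \<in> carrier G \<Longrightarrow> conj_by G g x = g \<otimes> x \<otimes> inv g"
  by (simp add: conj_by_def)

lemma conj_by_auto:
  assumes g: "g \<in> carrier G"
  shows "conj_by G g \<in> auto G"
  unfolding conj_by_def
proof (rule autoI)
  show "inj_on (\<lambda>h. g \<otimes> h \<otimes> inv g) (carrier G)"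
    using g by (auto intro!: inj_onI)
  show "g \<otimes> (x \<otimes> y) \<otimes> inv g = g \<otimes> x \<otimes> inv g \<otimes> (g \<otimes> y \<otimes> inv g)"
    if "x \<in> carrier G" "y \<in> carrier G" for x y
    using that g by (simp add: m_assoc) (simp flip: m_assoc)
  show "carrier G \<subseteq> (\<lambda>h. g \<otimes> h \<otimes> inv g) ` carrier G"
  proof
    fix x assume "x \<in> carrier G"
    then show "x \<in> (\<lambda>h. g \<otimes> h \<otimes> inv g) ` carrier G"
      using g by (intro image_eqI[of _ _ "inv g \<otimes> x \<otimes> g"]) (simp_all add: m_assoc, simp flip: m_assoc)
  qed
qed (use g in auto)

text \<open>Conjugation by g intertwines the two: both composites are conjugation by g p = q
  g.\<close>

lemma auto_conjugate_conj_by: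
  assumes p: "p \<in> carrier G" and g: "g \<in> carrier G" and eq: "g \<otimes> p = q \<otimes> g" and q: "q \<in> carrier G"
  shows "auto_conjugate (conj_by G p) (conj_by G q)"
  unfolding auto_conjugate_def
proof (intro bexI ballI)
  show "conj_by G g \<in> auto G" using g by (rule conj_by_auto)
  fix x assume x: "x \<in> carrier G"
  have "g \<otimes> (p \<otimes> x \<otimes> inv p) \<otimes> inv g = (g \<otimes> p) \<otimes> x \<otimes> inv (g \<otimes> p)"
    using x p g by (simp add: inv_mult_group m_assoc)
  also have "\<dots> = (q \<otimes> g) \<otimes> x \<otimes> inv (q \<otimes> g)" by (simp add: eq)
  also have "\<dots> = q \<otimes> (g \<otimes> x \<otimes> inv g) \<otimes> inv q"
    using x q g by (simp add: inv_mult_group m_assoc)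
  finally show "conj_by G g (conj_by G p x) = conj_by G q (conj_by G g x)"
    using x p q g by (simp add: conj_by_simp)
qed

text \<open>If conjugation by g p equals conjugation by q g, then these two elements differ by a
  central factor, which a trivial centre forces to be the identity.\<close>

lemma auto_conjugate_conj_by_iff:
  assumes inner: "\<And>\<psi>. \<psi> \<in> auto G \<Longrightarrow> \<exists>g\<in>carrier G. \<psi> = conj_by G g"
    and centre: "\<And>z. z \<in> carrier G \<Longrightarrow> (\<And>x. x \<in> carrier G \<Longrightarrow> z \<otimes> x = x \<otimes> z) \<Longrightarrow> z = \<one>"
    and p: "p \<in> carrier G" and q: "q \<in> carrier G"
  shows "auto_conjugate (conj_by G p) (conj_by G q) \<longleftrightarrow> (\<exists>g\<in>carrier G. g \<otimes> p = q \<otimes> g)"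
proof
  assume "auto_conjugate (conj_by G p) (conj_by G q)"
  then obtain g where g: "g \<in> carrier G"
    and eq: "\<And>x. x \<in> carrier G \<Longrightarrow> conj_by G g (conj_by G p x) = conj_by G q (conj_by G g x)"
    using inner unfolding auto_conjugate_def by metis
  define a b where "a = g \<otimes> p" and "b = q \<otimes> g"
  have ab: "a \<in> carrier G" "b \<in> carrier G" using p q g by (simp_all add: a_def b_def)
  have "(inv b \<otimes> a) \<otimes> x = x \<otimes> (inv b \<otimes> a)" if x: "x \<in> carrier G" for x
  proof -
    have "a \<otimes> x \<otimes> inv a = b \<otimes> x \<otimes> inv b"
      using eq[OF x] x p q g by (simp add: conj_by_simp inv_mult_group m_assoc a_def b_def)
    then have "inv b \<otimes> (a \<otimes> x \<otimes> inv a) \<otimes> a = inv b \<otimes> (b \<otimes> x \<otimes> inv b) \<otimes> a" by simp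
    moreover have "inv b \<otimes> (a \<otimes> x \<otimes> inv a) \<otimes> a = inv b \<otimes> a \<otimes> x"
      using ab x by (simp add: m_assoc)
    moreover have "inv b \<otimes> (b \<otimes> x \<otimes> inv b) \<otimes> a = inv b \<otimes> b \<otimes> x \<otimes> (inv b \<otimes> a)"
      using ab x by (simp only: m_assoc m_closed inv_closed)
    ultimately show ?thesis
      using ab x by simp
  qed
  then have "inv b \<otimes> a = \<one>"
    using centre ab by simp
  then have "g \<otimes> p = q \<otimes> g"
    using ab by (simp add: inv_solve_left' flip: a_def b_def)
  then show "\<exists>g\<in>carrier G. g \<otimes> p = q \<otimes> g" using g by blast
qed (use p q auto_conjugate_conj_by in blast)

theorem inner_correspondence:
  assumes inner: "\<And>\<psi>. \<psi> \<in> auto G \<Longrightarrow> \<exists>g\<in>carrier G. \<psi> = conj_by G g"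
    and centre: "\<And>z. z \<in> carrier G \<Longrightarrow> (\<And>x. x \<in> carrier G \<Longrightarrow> z \<otimes> x = x \<otimes> z) \<Longrightarrow> z = \<one>"
    and iso: "\<And>\<psi> \<phi>. \<psi> \<in> auto G \<Longrightarrow> \<phi> \<in> auto G \<Longrightarrow>
      gen_alexander G \<psi> \<cong>\<^sub>Q gen_alexander G \<phi> \<Longrightarrow> auto_conjugate \<psi> \<phi>"
  shows "\<exists>F. (\<forall>\<pi>\<in>carrier G. F (conj_class G \<pi>) = gen_alexander_class G (conj_by G \<pi>)) \<and>
    bij_betw F (conj_classes G) (gen_alexander_classes G)"
proof -
  have "gen_alexander_classes G = (\<lambda>\<pi>. gen_alexander_class G (conj_by G \<pi>)) ` carrier G"
  proof -
    have "auto G = conj_by G ` carrier G" using inner conj_by_auto by blast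
    then show ?thesis by (simp add: gen_alexander_classes_eq image_image)
  qed
  moreover have "conj_class G p = conj_class G q \<longleftrightarrow>
      gen_alexander_class G (conj_by G p) = gen_alexander_class G (conj_by G q)"
    if "p \<in> carrier G" "q \<in> carrier G" for p q
  proof -
    have "auto_conjugate (conj_by G p) (conj_by G q) \<longleftrightarrow>
        gen_alexander G (conj_by G p) \<cong>\<^sub>Q gen_alexander G (conj_by G q)"
      using that iso gen_alexander_iso_of_conjugate conj_by_auto by blast
    then show ?thesis
      unfolding conj_class_eq_iff[OF that]
        gen_alexander_class_eq_iff[OF conj_by_auto[OF that(1)] conj_by_auto[OF that(2)]]
      by (metis (no_types) auto_conjugate_conj_by_iff[OF inner centre that])
  qed
  ultimately show ?thesis
    unfolding conj_classes_eq by (simp only:) (rule bij_betw_factor, blast)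
qed

end

section \<open>Three-cycles and conjugation of permutations\<close>

text \<open>Induction from the end of the lists: a permutation that is right on the earlier entries
  is corrected by the transposition of \<open>s x\<close> and y, and neither of these points occurs
  among the earlier images. Source of all conjugating permutations with prescribed values.\<close>

lemma permutes_extend:
  assumes "distinct xs" "distinct ys" "length xs = length ys" "set xs \<subseteq> S" "set ys \<subseteq> S"
  shows "\<exists>s. s permutes S \<and> map s xs = ys"
  using assms(3,1,2,4,5)
proof (induction xs ys rule: rev_induct2)
  case 1
  show ?case by (auto intro: permutes_id)
next
  case (4 x xs y ys)
  then obtain s where s: "s permutes S" "map s xs = ys" by auto
  have ys: "set ys = s ` set xs" using s(2) by auto
  then have sx: "s x \<notin> set ys"
    using 4 inj_image_mem_iff[OF permutes_inj[OF s(1)]] by auto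
  have "s x \<in> S" "y \<in> S" using 4 s by (simp_all add: permutes_in_image)
  then have "transpose (s x) y \<circ> s permutes S"
    using s(1) by (intro permutes_compose permutes_swap_id)
  moreover have "map (transpose (s x) y \<circ> s) xs = map s xs"
  proof -
    have "y \<notin> set ys" using 4(4) by simp
    then have "transpose (s x) y z = z" if "z \<in> set ys" for z
      using sx that by (intro transpose_apply_other) auto
    then show ?thesis by (simp add: ys)
  qed
  ultimately show ?case
    using s(2) by (intro exI[of _ "transpose (s x) y \<circ> s"]) (auto simp: o_def)
qed auto

text \<open>For distinct points the cycle a to b to c to a. The product of transpositions makes
  evenness immediate and agrees with \<open>cycle_of_list [a, b, c]\<close>.\<close>

definition cyc3 :: "'a \<Rightarrow> 'a \<Rightarrow> 'a \<Rightarrow> 'a \<Rightarrow> 'a"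
  where "cyc3 a b c = transpose a b \<circ> transpose b c"

definition three_cycle :: "'a set \<Rightarrow> ('a \<Rightarrow> 'a) \<Rightarrow> bool"
  where "three_cycle S p \<longleftrightarrow> (\<exists>a b c. distinct [a, b, c] \<and> {a, b, c} \<subseteq> S \<and> p = cyc3 a b c)"

lemma cyc3_apply:
  "distinct [a, b, c] \<Longrightarrow>
    cyc3 a b c x = (if x = a then b else if x = b then c else if x = c then a else x)"
  by (auto simp: cyc3_def transpose_def)

lemma cyc3_rotate: "distinct [a, b, c] \<Longrightarrow> cyc3 a b c = cyc3 b c a"
  by (auto simp: fun_eq_iff cyc3_apply)

lemma cyc3_square: "distinct [a, b, c] \<Longrightarrow> cyc3 a b c \<circ> cyc3 a b c = cyc3 b a c"
  by (auto simp: fun_eq_iff cyc3_apply)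

lemma cyc3_cube: "distinct [a, b, c] \<Longrightarrow> cyc3 a b c \<circ> cyc3 a b c \<circ> cyc3 a b c = id"
  by (auto simp: fun_eq_iff cyc3_apply)

lemma inv_cyc3:
  assumes "distinct [a, b, c]"
  shows "inv' (cyc3 a b c) = cyc3 b a c"
  using assms by (intro inv_unique_comp) (auto simp: fun_eq_iff cyc3_apply split: if_splits)

lemma cyc3_permutes: "{a, b, c} \<subseteq> S \<Longrightarrow> cyc3 a b c permutes S"
  by (simp add: cyc3_def permutes_compose permutes_swap_id)

lemma evenperm_cyc3: "distinct [a, b, c] \<Longrightarrow> evenperm (cyc3 a b c)"
  by (simp add: cyc3_def evenperm_comp permutation_swap_id evenperm_swap)

lemma cyc3_neq_id: "distinct [a, b, c] \<Longrightarrow> cyc3 a b c \<noteq> id"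
  by (metis cyc3_apply distinct_length_2_or_more id_apply)

lemma three_cycle_permutes: "three_cycle S p \<Longrightarrow> p permutes S"
  by (auto simp: three_cycle_def intro: cyc3_permutes)

lemma three_cycle_even: "three_cycle S p \<Longrightarrow> evenperm p"
  unfolding three_cycle_def by (metis evenperm_cyc3)

lemma three_cycle_neq_id: "three_cycle S p \<Longrightarrow> p \<noteq> id"
  unfolding three_cycle_def by (metis cyc3_neq_id)

lemma three_cycle_cube: "three_cycle S p \<Longrightarrow> p \<circ> p \<circ> p = id"
  unfolding three_cycle_def by (metis cyc3_cube)

lemma three_cycleI: "distinct [a, b, c] \<Longrightarrow> {a, b, c} \<subseteq> S \<Longrightarrow> three_cycle S (cyc3 a b c)"
  by (auto simp: three_cycle_def)

lemma permutes_comp_transpose: "s permutes S \<Longrightarrow> s \<circ> transpose a b = transpose (s a) (s b) \<circ> s"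
  using permutes_inj[of s S] by (auto simp: fun_eq_iff transpose_def inj_eq)

lemma permutes_comp_cyc3:
  assumes "s permutes S"
  shows "s \<circ> cyc3 a b c = cyc3 (s a) (s b) (s c) \<circ> s"
  unfolding cyc3_def o_assoc permutes_comp_transpose[OF assms]
  by (simp only: comp_assoc permutes_comp_transpose[OF assms])

text \<open>Unlike \<open>conj_by\<close> it is not restricted to a carrier, so its laws are plain
  equations between functions.\<close>

definition conj_perm :: "('a \<Rightarrow> 'a) \<Rightarrow> ('a \<Rightarrow> 'a) \<Rightarrow> 'a \<Rightarrow> 'a"
  where "conj_perm s x = s \<circ> x \<circ> inv' s"

lemma conj_perm_permutes: "s permutes S \<Longrightarrow> x permutes S \<Longrightarrow> conj_perm s x permutes S"
  by (simp add: conj_perm_def permutes_compose permutes_inv)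

lemma conj_perm_eq_iff: "s permutes S \<Longrightarrow> conj_perm s x = y \<longleftrightarrow> s \<circ> x = y \<circ> s"
  unfolding conj_perm_def by (metis comp_assoc comp_id permutes_inv_o)

lemma conj_perm_comp: "s permutes S \<Longrightarrow> conj_perm s x \<circ> s = s \<circ> x"
  using conj_perm_eq_iff by metis

lemma conj_perm_comp_left:
  "s permutes S \<Longrightarrow> t permutes S \<Longrightarrow> conj_perm (s \<circ> t) x = conj_perm s (conj_perm t x)"
  by (subst conj_perm_eq_iff[of _ S]) (simp add: permutes_compose, metis comp_assoc conj_perm_comp)

lemma conj_perm_comp_right: "s permutes S \<Longrightarrow> conj_perm s (x \<circ> y) = conj_perm s x \<circ> conj_perm s y"
  by (subst conj_perm_eq_iff[of _ S]) (simp, metis comp_assoc conj_perm_comp)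

lemma conj_perm_inj: "s permutes S \<Longrightarrow> conj_perm s x = conj_perm s y \<longleftrightarrow> x = y"
  by (metis conj_perm_comp comp_assoc id_comp permutes_inv_o(2))

lemma conj_perm_id [simp]: "s permutes S \<Longrightarrow> conj_perm s id = id"
  by (subst conj_perm_eq_iff) auto

lemma evenperm_conj_perm:
  assumes "finite S" "s permutes S" "x permutes S"
  shows "evenperm (conj_perm s x) \<longleftrightarrow> evenperm x"
proof -
  have "permutation s" "permutation x" "permutation (inv' s)"
    using assms permutes_inv permutes_imp_permutation by blast+
  then show ?thesis
    by (auto simp: conj_perm_def evenperm_comp permutation_compose evenperm_inv)
qed

lemma conj_perm_three_cycle:
  assumes s: "s permutes S" and x: "three_cycle S x"
  shows "three_cycle S (conj_perm s x)"
proof -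
  obtain a b c where abc: "distinct [a, b, c]" "{a, b, c} \<subseteq> S" "x = cyc3 a b c"
    using x by (auto simp: three_cycle_def)
  have "conj_perm s x = cyc3 (s a) (s b) (s c)"
    using s permutes_comp_cyc3 abc(3) by (subst conj_perm_eq_iff[of _ S]) auto
  moreover have "distinct [s a, s b, s c]"
    using abc(1) permutes_inj[OF s] by (auto simp: inj_eq)
  moreover have "{s a, s b, s c} \<subseteq> S"
    using abc(2) by (auto simp: permutes_in_image[OF s])
  ultimately show ?thesis by (auto simp: three_cycle_def)
qed

lemma three_cycles_conjugate:
  assumes "three_cycle S p" "three_cycle S q"
  obtains s where "s permutes S" "conj_perm s p = q"
proof -
  obtain a b c where abc: "distinct [a, b, c]" "{a, b, c} \<subseteq> S" "p = cyc3 a b c"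
    using assms(1) by (auto simp: three_cycle_def)
  obtain d e f where def: "distinct [d, e, f]" "{d, e, f} \<subseteq> S" "q = cyc3 d e f"
    using assms(2) by (auto simp: three_cycle_def)
  obtain s where s: "s permutes S" "map s [a, b, c] = [d, e, f]"
    using permutes_extend[OF abc(1) def(1)] abc(2) def(2) by auto
  then have "conj_perm s p = q"
    using permutes_comp_cyc3[OF s(1), of a b c] abc def
    by (subst conj_perm_eq_iff[OF s(1)]) auto
  then show thesis using that s by blast
qed

text \<open>Rests on the generation of A_n by three-cycles. The case of inverses in
  \<open>generate\<close> disappears because the inverse of a three-cycle is a three-cycle.\<close>

lemma evenperm_induct [consumes 2, case_names id cycle comp]:
  fixes n :: nat
  assumes p: "p permutes {1..n}" "evenperm p"
    and id: "P id"
    and cycle: "\<And>c. three_cycle {1..n} c \<Longrightarrow> P c"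
    and comp: "\<And>p q. p permutes {1..n} \<Longrightarrow> evenperm p \<Longrightarrow> q permutes {1..n} \<Longrightarrow> evenperm q \<Longrightarrow>
      P p \<Longrightarrow> P q \<Longrightarrow> P (p \<circ> q)"
  shows "P p"
proof -
  interpret alt: group "alt_group n" by (rule alt_group_is_group)
  have three: "three_cycle {1..n} c" if c: "c \<in> three_cycles n" for c
  proof -
    obtain cs where cs: "c = cycle_of_list cs" "cycle cs" "length cs = 3" "set cs \<subseteq> {1..n}"
      using c by auto
    then obtain a b d where "cs = [a, b, d]" using stupid_lemma by blast
    then show ?thesis using cs by (auto simp: three_cycle_def cyc3_def)
  qed
  have "p \<in> generate (alt_group n) (three_cycles n)"
    by (metis p alt_group_carrier alt_group_carrier_as_three_cycles)
  then show ?thesis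
  proof (induction rule: generate.induct)
    case one
    then show ?case using id by (simp only: alt_group_one)
  next
    case (incl h)
    then show ?case using three cycle by blast
  next
    case (inv h)
    then have "h \<in> carrier (alt_group n)" using three_cycles_incl by blast
    then have "inv\<^bsub>alt_group n\<^esub> h = inv' h" by (rule alt_group_inv_equality)
    moreover obtain a b c where "distinct [a, b, c]" "{a, b, c} \<subseteq> {1..n}" "h = cyc3 a b c"
      using three[OF inv] by (auto simp: three_cycle_def)
    then have "three_cycle {1..n} (inv' h)"
      by (simp add: inv_cyc3) (auto intro!: three_cycleI)
    ultimately show ?case using cycle by simp
  next
    case (eng h1 h2)
    have "h1 \<in> carrier (alt_group n)" "h2 \<in> carrier (alt_group n)"
      using eng(1,2) alt_group_carrier_as_three_cycles by auto
    then show ?case unfolding alt_group_mult alt_group_carrier using eng comp by blast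
  qed
qed

text \<open>The three-cycles through one arrow from x to y generate the others: squaring reverses
  the arrow, a product of a cycle with a reversed one drops x or y, and two cycles through x compose
  to one that avoids both. Closure of P is asked for only when both factors are
  three-cycles.\<close>

lemma three_cycle_star_generation:
  assumes xy: "x \<in> S" "y \<in> S" "x \<noteq> y"
    and star: "\<And>i. i \<in> S \<Longrightarrow> i \<noteq> x \<Longrightarrow> i \<noteq> y \<Longrightarrow> P (cyc3 x y i)"
    and comp: "\<And>p q. three_cycle S p \<Longrightarrow> three_cycle S q \<Longrightarrow> P p \<Longrightarrow> P q \<Longrightarrow> P (p \<circ> q)"
    and c: "three_cycle S c"
  shows "P c"
proof -
  have s0: "P (cyc3 y x i)" if "i \<in> S" "i \<noteq> x" "i \<noteq> y" for i
  proof -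
    have "cyc3 x y i \<circ> cyc3 x y i = cyc3 y x i" using that xy by (intro cyc3_square) auto
    then show ?thesis using comp[OF _ _ star star, of i i] that xy by (simp add: three_cycleI)
  qed
  have s1: "P (cyc3 x i j)" if "i \<in> S" "j \<in> S" "distinct [x, y, i, j]" for i j
  proof -
    have "cyc3 x y j \<circ> cyc3 y x i = cyc3 x i j"
      using that xy by (auto simp: fun_eq_iff cyc3_apply)
    then show ?thesis using comp[OF _ _ star s0, of j i] that xy by (auto simp: three_cycleI)
  qed
  have s2: "P (cyc3 y j i)" if "i \<in> S" "j \<in> S" "distinct [x, y, i, j]" for i j
  proof -
    have "cyc3 y x i \<circ> cyc3 x y j = cyc3 y j i"
      using that xy by (auto simp: fun_eq_iff cyc3_apply)
    then show ?thesis using comp[OF _ _ s0 star, of i j] that xy by (auto simp: three_cycleI)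
  qed
  have s3: "P (cyc3 i j k)" if "i \<in> S" "j \<in> S" "k \<in> S" "distinct [x, y, i, j, k]" for i j k
  proof -
    have "cyc3 x i j \<circ> cyc3 x j k = cyc3 i j k"
      using that xy by (auto simp: fun_eq_iff cyc3_apply)
    then show ?thesis using comp[OF _ _ s1 s1, of i j j k] that xy by (auto simp: three_cycleI)
  qed
  have x_first: "P (cyc3 x b c)" if "b \<in> S" "c \<in> S" "distinct [x, b, c]" for b c
  proof (cases "b = y \<or> c = y")
    case True
    then show ?thesis using that star[of c] s0[of b] cyc3_rotate[of x b y] cyc3_rotate[of b y x] by auto
  qed (use that s1 xy in auto)
  obtain a b d where abd: "distinct [a, b, d]" "{a, b, d} \<subseteq> S" "c = cyc3 a b d"
    using c by (auto simp: three_cycle_def)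
  have rot: "cyc3 a b d = cyc3 b d a" "cyc3 a b d = cyc3 d a b"
    using abd(1) by (auto simp: fun_eq_iff cyc3_apply)
  \<comment> \<open>Rotates the cycle until u comes first; u will be x if x occurs in the cycle, and
    otherwise y.\<close>
  have first: "P (cyc3 a b d)"
    if u: "\<And>b c. b \<in> S \<Longrightarrow> c \<in> S \<Longrightarrow> distinct [u, b, c] \<Longrightarrow> x \<notin> {b, c} \<Longrightarrow> P (cyc3 u b c)"
      "u \<in> {a, b, d}" "x \<notin> {a, b, d} \<or> x = u" for u
  proof -
    consider "u = a" | "u = b" | "u = d" using u(2) by auto
    then show ?thesis
    proof cases
      case 1
      then show ?thesis using u(1)[of b d] u(3) abd by auto
    next
      case 2
      then have "P (cyc3 b d a)" using u(1)[of d a] u(3) abd by auto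
      then show ?thesis by (simp only: rot(1))
    next
      case 3
      then have "P (cyc3 d a b)" using u(1)[of a b] u(3) abd by auto
      then show ?thesis by (simp only: rot(2))
    qed
  qed
  have y_first: "P (cyc3 y b c)" if "b \<in> S" "c \<in> S" "distinct [y, b, c]" "x \<notin> {b, c}" for b c
    using s2[of c b] that xy by auto
  consider "x \<in> {a, b, d}" | "x \<notin> {a, b, d}" "y \<in> {a, b, d}" | "x \<notin> {a, b, d}" "y \<notin> {a, b, d}"
    by blast
  then have "P (cyc3 a b d)"
  proof cases
    case 1
    then show ?thesis using first[of x] x_first by blast
  next
    case 2
    then show ?thesis using first[of y] y_first by blast
  next
    case 3
    then show ?thesis using s3[of a b d] abd xy by auto
  qed
  then show ?thesis by (simp add: abd(3))
qed

section \<open>Centralizers, normal subgroups and products of three-cycles\<close>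

lemma card_diff_nonempty:
  assumes "finite S" "card (set xs) < card S"
  obtains x where "x \<in> S" "x \<notin> set xs"
  using assms by (metis List.finite_set card_mono linorder_not_le subsetI)

text \<open>If z moves a, a three-cycle (a c d) that fixes \<open>z a\<close> cannot commute with z:
  evaluating at a would give z c = z a. The points a, \<open>z a\<close>, c, d account for the bound
  four.\<close>

lemma commute_three_cycles_imp_id:
  assumes S: "finite S" "4 \<le> card S" and z: "z permutes S"
    and comm: "\<And>c. three_cycle S c \<Longrightarrow> z \<circ> c = c \<circ> z"
  shows "z = id"
proof (rule ccontr)
  assume "z \<noteq> id"
  then obtain a where a: "z a \<noteq> a" by fastforce
  then have aS: "a \<in> S" using z by (metis permutes_not_in)
  obtain c where c: "c \<in> S" "c \<notin> set [a, z a]"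
    using card_diff_nonempty[of S "[a, z a]"] S card_length[of "[a, z a]"] by auto
  obtain d where d: "d \<in> S" "d \<notin> set [a, z a, c]"
    using card_diff_nonempty[of S "[a, z a, c]"] S card_length[of "[a, z a, c]"] by auto
  have dist: "distinct [a, c, d]" using c d by auto
  have "(z \<circ> cyc3 a c d) a = (cyc3 a c d \<circ> z) a"
    using comm[of "cyc3 a c d"] dist aS c d by (simp add: three_cycleI)
  then have "z c = z a" using c d a by (auto simp: cyc3_apply[OF dist])
  then show False using dist permutes_inj[OF z] by (auto simp: inj_eq)
qed

text \<open>The same evaluation with a transposition (a c) that fixes \<open>z a\<close>, for which
  three points are enough.\<close>

lemma commute_transpositions_imp_id:
  assumes S: "finite S" "3 \<le> card S" and z: "z permutes S"
    and comm: "\<And>a b. a \<in> S \<Longrightarrow> b \<in> S \<Longrightarrow> a \<noteq> b \<Longrightarrow> z \<circ> transpose a b = transpose a b \<circ> z"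
  shows "z = id"
proof (rule ccontr)
  assume "z \<noteq> id"
  then obtain a where a: "z a \<noteq> a" by fastforce
  then have aS: "a \<in> S" using z by (metis permutes_not_in)
  obtain c where c: "c \<in> S" "c \<notin> set [a, z a]"
    using card_diff_nonempty[of S "[a, z a]"] S card_length[of "[a, z a]"] by auto
  have "(z \<circ> transpose a c) a = (transpose a c \<circ> z) a"
    using fun_cong[OF comm[of a c], of a] aS c by auto
  then have "z c = z a" using c a by (auto simp: transpose_def)
  then show False using c permutes_inj[OF z] by (auto simp: inj_eq)
qed

lemma order_three_orbit:
  assumes y: "y \<circ> y \<circ> y = id" "y a \<noteq> a"
  shows "y (y (y a)) = a" "distinct [a, y a, y (y a)]"
proof -
  show cube: "y (y (y x)) = x" for x using fun_cong[OF y(1), of x] by simp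
  then show "distinct [a, y a, y (y a)]" using y(2) by (auto, metis+)
qed

text \<open>If y consists of a single three-cycle, two of its fixed points can be exchanged. If
  there is a second three-cycle, exchanging the two cycles pointwise is a product of three
  transpositions, hence odd.\<close>

lemma order_three_commutes_odd:
  assumes S: "finite S" "5 \<le> card S"
    and y: "y permutes S" "y \<circ> y \<circ> y = id" "y \<noteq> id"
  obtains u where "u permutes S" "\<not> evenperm u" "conj_perm u y = y"
proof -
  have cube: "y (y (y x)) = x" for x using fun_cong[OF y(2), of x] by simp
  have moved: "x \<in> S" if "y x \<noteq> x" for x using y(1) that by (metis permutes_not_in)
  have inj: "y v = y w \<longleftrightarrow> v = w" for v w using permutes_inj[OF y(1)] by (simp add: inj_eq)
  have mem: "y x \<in> S \<longleftrightarrow> x \<in> S" for x using permutes_in_image[OF y(1)] .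
  obtain a where a: "y a \<noteq> a" using y(3) by fastforce
  note abc = order_three_orbit(2)[OF y(2) a]
  show thesis
  proof (cases "\<exists>d. d \<notin> {a, y a, y (y a)} \<and> y d \<noteq> d")
    case True
    then obtain d where d: "d \<notin> {a, y a, y (y a)}" "y d \<noteq> d" by blast
    define b c e f where bcef: "b = y a" "c = y b" "e = y d" "f = y e"
    have y_vals: "y a = b" "y b = c" "y c = a" "y d = e" "y e = f" "y f = d"
      by (simp_all add: bcef cube)
    have "distinct [a, b, c]" using abc by (simp add: bcef)
    moreover have "distinct [d, e, f]" using order_three_orbit(2)[OF y(2) d(2)] by (simp add: bcef)
    moreover have D: "d \<notin> {a, b, c}" using d(1) by (simp add: bcef)
    moreover have E: "e \<notin> {a, b, c}"
      using D inj[of d a] inj[of d b] inj[of d c] unfolding y_vals by blast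
    moreover have "f \<notin> {a, b, c}"
      using E inj[of e a] inj[of e b] inj[of e c] unfolding y_vals by blast
    ultimately have dist: "distinct [a, b, c, d, e, f]" by auto
    define u where "u = transpose a d \<circ> transpose b e \<circ> transpose c f"
    have "y \<circ> u = transpose b e \<circ> transpose c f \<circ> transpose a d \<circ> y"
      unfolding u_def o_assoc permutes_comp_transpose[OF y(1)]
      by (simp only: comp_assoc permutes_comp_transpose[OF y(1)] y_vals)
    also have "transpose b e \<circ> transpose c f \<circ> transpose a d = u"
      using dist by (auto simp: u_def fun_eq_iff transpose_def)
    finally have comm: "u \<circ> y = y \<circ> u" by (rule sym)
    have "{a, b, c, d, e, f} \<subseteq> S" using moved[OF a] moved[OF d(2)] by (simp add: bcef mem)
    then have u: "u permutes S"
      unfolding u_def by (intro permutes_compose permutes_swap_id) auto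
    moreover have "\<not> evenperm u"
      using dist unfolding u_def
      by (simp add: evenperm_comp permutation_compose permutation_swap_id evenperm_swap)
    ultimately show thesis using that comm conj_perm_eq_iff by metis
  next
    case False
    obtain b where b: "b \<in> S" "b \<notin> set [a, y a, y (y a)]"
      using card_diff_nonempty[of S "[a, y a, y (y a)]"] S card_length[of "[a, y a, y (y a)]"] by auto
    obtain c where c: "c \<in> S" "c \<notin> set [a, y a, y (y a), b]"
      using card_diff_nonempty[of S "[a, y a, y (y a), b]"] S
        card_length[of "[a, y a, y (y a), b]"] by auto
    have "y b = b" "y c = c" using False b c by auto
    then have "transpose b c \<circ> y = y \<circ> transpose b c"
      using permutes_comp_transpose[OF y(1), of b c] by simp
    moreover have "transpose b c permutes S" using b c by (intro permutes_swap_id)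
    moreover have "\<not> evenperm (transpose b c)" using c by (auto simp: evenperm_swap)
    ultimately show thesis using that conj_perm_eq_iff by metis
  qed
qed

text \<open>The commutator of a permutation with a transposition is a product of two transpositions; a
  further commutator turns a product of two disjoint transpositions into a three-cycle.\<close>

lemma conj_closed_contains_three_cycles:
  assumes S: "finite S" "5 \<le> card S"
    and perm: "\<And>p. p \<in> N \<Longrightarrow> p permutes S"
    and comp: "\<And>p q. p \<in> N \<Longrightarrow> q \<in> N \<Longrightarrow> p \<circ> q \<in> N"
    and inv: "\<And>p. p \<in> N \<Longrightarrow> inv' p \<in> N"
    and conj: "\<And>p s. p \<in> N \<Longrightarrow> s permutes S \<Longrightarrow> conj_perm s p \<in> N"
    and h: "h \<in> N" "h \<noteq> id"
    and c: "three_cycle S c"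
  shows "c \<in> N"
proof -
  have hp: "h permutes S" using perm h by blast
  have comm: "transpose (h a) (h c) \<circ> transpose a c \<in> N" if "a \<in> S" "c \<in> S" for a c
  proof -
    let ?t = "transpose a c"
    have "conj_perm ?t (inv' h) \<in> N"
      using that by (intro conj inv h permutes_swap_id)
    then have "h \<circ> conj_perm ?t (inv' h) \<in> N" using comp h by blast
    moreover have "h \<circ> conj_perm ?t (inv' h) = (h \<circ> ?t) \<circ> inv' h \<circ> ?t"
      by (simp add: conj_perm_def comp_assoc)
    moreover have "\<dots> = transpose (h a) (h c) \<circ> (h \<circ> inv' h) \<circ> ?t"
      by (simp only: permutes_comp_transpose[OF hp] comp_assoc)
    ultimately show ?thesis using permutes_inv_o(1)[OF hp] by simp
  qed
  obtain a where a: "h a \<noteq> a" using h by fastforce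
  then have aS: "a \<in> S" using hp by (metis permutes_not_in)
  define b where "b = h a"
  have bS: "b \<in> S" using aS hp by (simp add: b_def permutes_in_image)
  obtain d where d: "d \<in> S" "d \<notin> set [a, b]"
    using card_diff_nonempty[of S "[a, b]"] S card_length[of "[a, b]"] by auto
  have hd: "h d \<in> S" "h d \<noteq> b"
    using d hp permutes_inj[OF hp] by (auto simp: permutes_in_image b_def inj_eq)
  have ab: "a \<noteq> b" using a by (simp add: b_def)
  have q: "transpose b (h d) \<circ> transpose a d \<in> N"
    using comm[OF aS d(1)] by (simp add: b_def)
  have "\<exists>p\<in>N. three_cycle S p"
  proof -
    consider "h d = a" | "h d = d" | "h d \<notin> {a, d}" by blast
    then show ?thesis
    proof cases
      case 1
      then have "cyc3 b a d \<in> N" using q by (simp add: cyc3_def)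
      moreover have "three_cycle S (cyc3 b a d)" using ab aS bS d by (intro three_cycleI) auto
      ultimately show ?thesis by blast
    next
      case 2
      then have "cyc3 b d a \<in> N" using q by (simp add: cyc3_def transpose_commute)
      moreover have "three_cycle S (cyc3 b d a)" using ab aS bS d by (intro three_cycleI) auto
      ultimately show ?thesis by blast
    next
      case 3
      define f where "f = h d"
      \<comment> \<open>The fifth point is essential here: on four points the double transpositions
        and the identity form a normal subgroup without three-cycles.\<close>
      obtain e where e: "e \<in> S" "e \<notin> set [a, b, d, f]"
        using card_diff_nonempty[of S "[a, b, d, f]"] S card_length[of "[a, b, d, f]"] by auto
      have dist: "distinct [a, b, d, f, e]" using ab d hd 3 e by (auto simp: f_def)
      have "conj_perm (transpose a e) (transpose b f \<circ> transpose a d) = transpose b f \<circ> transpose e d"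
        using dist by (auto simp: conj_perm_def fun_eq_iff transpose_def)
      then have "transpose b f \<circ> transpose e d \<in> N"
        using conj[OF q permutes_swap_id[OF aS e(1)]] by (simp add: f_def)
      with q have "(transpose b f \<circ> transpose a d) \<circ> (transpose b f \<circ> transpose e d) \<in> N"
        using comp by (simp add: f_def)
      also have "(transpose b f \<circ> transpose a d) \<circ> (transpose b f \<circ> transpose e d) = cyc3 a d e"
        using dist by (auto simp: cyc3_def fun_eq_iff transpose_def)
      finally have "cyc3 a d e \<in> N" .
      moreover have "three_cycle S (cyc3 a d e)" using dist aS d e by (intro three_cycleI) auto
      ultimately show ?thesis by blast
    qed
  qed
  then obtain p where p: "p \<in> N" "three_cycle S p" by blast
  obtain s where "s permutes S" "conj_perm s p = c" using three_cycles_conjugate[OF p(2) c] .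
  then show ?thesis using conj p(1) by blast
qed

lemma three_cycle_at:
  assumes "three_cycle S p" "p z \<noteq> z"
  shows "p = cyc3 z (p z) (p (p z))"
proof -
  obtain a b c where abc: "distinct [a, b, c]" "p = cyc3 a b c"
    using assms(1) by (auto simp: three_cycle_def)
  have rot: "p = cyc3 b c a" "p = cyc3 c a b"
    using abc cyc3_rotate[of a b c] cyc3_rotate[of b c a] by auto
  have vals: "p a = b" "p b = c" "p c = a" "z \<in> {a, b, c}"
    using assms(2) abc by (auto simp: cyc3_apply split: if_splits)
  then show ?thesis
    by (metis abc(2) rot insertE singletonD)
qed

lemma three_cycle_distinct: "three_cycle S p \<Longrightarrow> p z \<noteq> z \<Longrightarrow> distinct [z, p z, p (p z)]"
  by (rule order_three_orbit(2)[OF three_cycle_cube])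

text \<open>Read three-cycles as directed triangles. Without a common vertex the product has order
  three. With a common vertex but no common arrow, either the two are inverse to each other or the
  square of the product moves a point.\<close>

lemma three_cycle_pair:
  assumes p: "three_cycle S p" and q: "three_cycle S q"
    and pq: "(p \<circ> q) \<circ> (p \<circ> q) = id" "p \<circ> q \<noteq> id"
  shows "\<exists>z. p z \<noteq> z \<and> q z = p z"
proof (rule ccontr)
  assume no: "\<not> ?thesis"
  have inv: "p (q (p (q z))) = z" for z using fun_cong[OF pq(1), of z] by simp
  have no: "q z \<noteq> p z" if "p z \<noteq> z" for z using no that by blast
  show False
  proof (cases "\<exists>z. p z \<noteq> z \<and> q z \<noteq> z")
    case True
    then obtain z where z: "p z \<noteq> z" "q z \<noteq> z" by blast
    obtain b c where bc: "distinct [z, b, c]" "p = cyc3 z b c"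
      using three_cycle_at[OF p z(1)] three_cycle_distinct[OF p z(1)] by blast
    obtain e f where ef: "distinct [z, e, f]" "q = cyc3 z e f"
      using three_cycle_at[OF q z(2)] three_cycle_distinct[OF q z(2)] by blast
    note p_vals = cyc3_apply[OF bc(1), folded bc(2)] and q_vals = cyc3_apply[OF ef(1), folded ef(2)]
    have be: "b \<noteq> e" using no[OF z(1)] bc(1) ef(1) by (simp add: p_vals q_vals)
    show False
    proof (cases "b = f")
      case True
      show False
      proof (cases "c = e")
        case True
        then have "p \<circ> q = id" using \<open>b = f\<close> bc(1) by (auto simp: fun_eq_iff p_vals q_vals)
        then show False using pq(2) by blast
      next
        case False
        then show False using inv[of e] \<open>b = f\<close> bc(1) ef(1) by (auto simp: p_vals q_vals)
      qed
    next
      case False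
      then have "c = f" using inv[of f] be bc(1) ef(1) by (auto simp: p_vals q_vals split: if_splits)
      then show False using no[of c] bc(1) ef(1) by (auto simp: p_vals q_vals)
    qed
  next
    case False
    obtain a where a: "p a \<noteq> a" using three_cycle_neq_id[OF p] by fastforce
    have dist: "distinct [a, p a, p (p a)]" using three_cycle_distinct[OF p a] .
    then have "q a = a" "q (p a) = p a" using False by (metis distinct_length_2_or_more)+
    then show False using inv[of a] dist by auto
  qed
qed

section \<open>Automorphisms of alternating and symmetric groups\<close>

text \<open>The images of \<open>(1 2 i)\<close> and \<open>(1 2 j)\<close> have a product of order two, hence share an arrow of
  their cycles. All these images share one arrow, and sending \<open>(1, 2)\<close> to it and \<open>i\<close> to the third
  point of the image of \<open>(1 2 i)\<close> defines the conjugating permutation.\<close>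

lemma three_cycle_preserving_is_conjugation:
  fixes n :: nat
  assumes n: "3 \<le> n"
    and hom: "\<And>p q. p permutes {1..n} \<Longrightarrow> evenperm p \<Longrightarrow> q permutes {1..n} \<Longrightarrow> evenperm q \<Longrightarrow>
      \<alpha> (p \<circ> q) = \<alpha> p \<circ> \<alpha> q"
    and inj: "inj_on \<alpha> {p. p permutes {1..n} \<and> evenperm p}"
    and pres: "\<And>c. three_cycle {1..n} c \<Longrightarrow> three_cycle {1..n} (\<alpha> c)"
  obtains t where "t permutes {1..n}"
    "\<And>p. p permutes {1..n} \<Longrightarrow> evenperm p \<Longrightarrow> \<alpha> p = conj_perm t p"
proof -
  let ?S = "{1..n}"
  have hom3: "\<alpha> (p \<circ> q) = \<alpha> p \<circ> \<alpha> q" if "three_cycle ?S p" "three_cycle ?S q" for p q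
    using hom that three_cycle_permutes three_cycle_even by blast
  have inj': "\<alpha> p = \<alpha> q \<longleftrightarrow> p = q"
    if "p permutes ?S" "evenperm p" "q permutes ?S" "evenperm q" for p q
    using inj_onD[OF inj] that by blast
  have \<alpha>_id: "\<alpha> id = id"
  proof -
    have c: "three_cycle ?S (cyc3 1 2 3)" using n by (intro three_cycleI) auto
    have "\<alpha> id \<circ> \<alpha> (cyc3 1 2 3) = \<alpha> (cyc3 1 2 3)"
      using hom[of id "cyc3 1 2 3"] three_cycle_permutes[OF c] three_cycle_even[OF c]
      by (simp add: permutes_id)
    then show ?thesis
      using three_cycle_permutes[OF pres[OF c]] by (metis comp_assoc comp_id permutes_inv_o(1))
  qed
  define c where "c = (\<lambda>i. \<alpha> (cyc3 1 2 i))"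
  have c3: "three_cycle ?S (cyc3 1 2 i)" if "i \<in> {3..n}" for i
    using that by (intro three_cycleI) auto
  have tc: "three_cycle ?S (c i)" if "i \<in> {3..n}" for i
    unfolding c_def using that by (intro pres c3)
  have c_inj: "c i \<noteq> c j" if "i \<in> {3..n}" "j \<in> {3..n}" "i \<noteq> j" for i j
  proof
    assume "c i = c j"
    then have "cyc3 1 2 i = cyc3 1 2 j"
      unfolding c_def using inj' c3 that three_cycle_permutes three_cycle_even by blast
    then have "cyc3 1 2 i 2 = cyc3 1 2 j 2" by simp
    then show False using that by (simp add: cyc3_apply)
  qed
  have share: "\<exists>z. c i z \<noteq> z \<and> c j z = c i z" if ij: "i \<in> {3..n}" "j \<in> {3..n}" "i \<noteq> j" for i j
  proof (rule three_cycle_pair[OF tc tc])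
    let ?r = "cyc3 1 2 i \<circ> cyc3 1 2 j"
    have r: "?r permutes ?S" "evenperm ?r"
      using three_cycle_permutes[OF c3[OF ij(1)]] three_cycle_permutes[OF c3[OF ij(2)]]
        three_cycle_even[OF c3[OF ij(1)]] three_cycle_even[OF c3[OF ij(2)]]
      by (auto intro!: permutes_compose simp: evenperm_comp permutes_imp_permutation[of ?S])
    have \<alpha>r: "\<alpha> ?r = c i \<circ> c j" unfolding c_def by (rule hom3[OF c3 c3]) (use ij in auto)
    have "?r \<circ> ?r = id" using ij by (auto simp: fun_eq_iff cyc3_apply)
    then show "(c i \<circ> c j) \<circ> (c i \<circ> c j) = id"
      using hom[OF r r] \<alpha>r \<alpha>_id by simp
    have "?r 1 \<noteq> 1" using ij by (simp add: cyc3_apply)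
    then have "?r \<noteq> id" by (metis id_apply)
    then show "c i \<circ> c j \<noteq> id"
      using inj'[OF r permutes_id] \<alpha>r \<alpha>_id by simp
  qed (use ij in auto)
  have "\<exists>a b. \<forall>i\<in>{3..n}. a \<noteq> b \<and> c i a = b"
  proof (cases "n = 3")
    case True
    obtain a where "c 3 a \<noteq> a" using three_cycle_neq_id[OF tc[of 3]] n by fastforce
    then show ?thesis using True by (intro exI[of _ a] exI[of _ "c 3 a"]) auto
  next
    case False
    then have n4: "3 \<in> {3..n}" "4 \<in> {3..n}" using n by auto
    obtain a where a: "c 3 a \<noteq> a" "c 4 a = c 3 a" using share[OF n4] by auto
    define b where "b = c 3 a"
    define x where "x = c 3 b"
    define y where "y = c 4 b"
    have c3_eq: "c 3 = cyc3 a b x" and dx: "distinct [a, b, x]"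
      unfolding b_def x_def
      by (rule three_cycle_at[OF tc[OF n4(1)] a(1)], rule three_cycle_distinct[OF tc[OF n4(1)] a(1)])
    have c4_eq: "c 4 = cyc3 a b y" and dy: "distinct [a, b, y]"
      using three_cycle_at[OF tc[OF n4(2)], of a] three_cycle_distinct[OF tc[OF n4(2)], of a] a
      unfolding b_def y_def by metis+
    have xy: "x \<noteq> y" using c_inj[OF n4] c3_eq c4_eq by auto
    have "c i a = b" if i: "i \<in> {3..n}" for i
    \<comment> \<open>A cycle \<open>c i\<close> without the arrow from a to b must share b to x or
      x to a with \<open>c 3\<close>, and b to y or y to a with \<open>c 4\<close>. Two arrows from
      b, or two into a, contradict x \<noteq> y; a mixed pair would put the four points a, b, x, y
      on one three-cycle, which \<open>no_both\<close> excludes.\<close>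
    proof (rule ccontr)
      assume no: "c i a \<noteq> b"
      then have i34: "i \<noteq> 3" "i \<noteq> 4" using a by (auto simp: b_def)
      obtain z where z: "c 3 z \<noteq> z" "c i z = c 3 z" using share[OF n4(1) i] i34 by auto
      obtain w where w: "c 4 w \<noteq> w" "c i w = c 4 w" using share[OF n4(2) i] i34 by auto
      have z': "(z = b \<and> c i b = x) \<or> (z = x \<and> c i x = a)"
        using z no dx by (auto simp: c3_eq cyc3_apply[OF dx] split: if_splits)
      have w': "(w = b \<and> c i b = y) \<or> (w = y \<and> c i y = a)"
        using w no dy by (auto simp: c4_eq cyc3_apply[OF dy] split: if_splits)
      have ci_inj: "c i u = c i v \<longleftrightarrow> u = v" for u v
        using permutes_inj[OF three_cycle_permutes[OF tc[OF i]]] by (simp add: inj_eq)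
      have no_both: False if "c i b = u" "c i v = a" "distinct [a, b, u, v]" for u v
      proof -
        have ne: "c i b \<noteq> b" using that by auto
        have "c i = cyc3 b u (c i u)" "distinct [b, u, c i u]"
          using three_cycle_at[OF tc[OF i] ne] three_cycle_distinct[OF tc[OF i] ne]
          unfolding that(1) by blast+
        then have "c i v = (if v = b then u else if v = u then c i u else if v = c i u then b else v)"
          using cyc3_apply by metis
        then show False using that by (auto split: if_splits)
      qed
      show False
        using z' w' xy dx dy ci_inj[of x y] no_both[of x y] no_both[of y x] by auto
    qed
    then show ?thesis using dx by (intro exI[of _ a] exI[of _ b]) auto
  qed
  then obtain a b where ab: "\<And>i. i \<in> {3..n} \<Longrightarrow> a \<noteq> b \<and> c i a = b" by blast
  have ab_neq: "a \<noteq> b" using ab[of 3] n by auto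
  have c_eq: "c i = cyc3 a b (c i b)" and c_dist: "distinct [a, b, c i b]" if "i \<in> {3..n}" for i
    using three_cycle_at[OF tc[OF that], of a] three_cycle_distinct[OF tc[OF that], of a] ab[OF that]
    by metis+
  have c_mem: "a \<in> ?S" "b \<in> ?S" "c i b \<in> ?S" if "i \<in> {3..n}" for i
  proof -
    have "x \<in> ?S" if "c i x \<noteq> x" for x
      using three_cycle_permutes[OF tc[OF \<open>i \<in> {3..n}\<close>]] that by (metis permutes_not_in)
    then show "a \<in> ?S" "b \<in> ?S" "c i b \<in> ?S"
      using c_dist[OF that] ab[OF that] permutes_in_image[OF three_cycle_permutes[OF tc[OF that]]]
      by auto
  qed
  have third_inj: "inj_on (\<lambda>i. c i b) {3..n}"
    by (rule inj_onI) (metis c_eq c_inj)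
  obtain t where t: "t permutes ?S" "map t (1 # 2 # [3..<Suc n]) = a # b # map (\<lambda>i. c i b) [3..<Suc n]"
  proof -
    have "\<exists>t. t permutes ?S \<and> map t (1 # 2 # [3..<Suc n]) = a # b # map (\<lambda>i. c i b) [3..<Suc n]"
    proof (rule permutes_extend)
      have "c i b \<noteq> a" "c i b \<noteq> b" if "i \<in> {3..n}" for i using c_dist[OF that] by auto
      then have "a \<notin> (\<lambda>i. c i b) ` {3..n}" "b \<notin> (\<lambda>i. c i b) ` {3..n}" by (metis imageE)+
      moreover have upt: "{3..<Suc n} = {3..n}" by auto
      ultimately show "distinct (a # b # map (\<lambda>i. c i b) [3..<Suc n])"
        using third_inj ab_neq by (simp add: distinct_map del: upt_Suc)
      show "set (a # b # map (\<lambda>i. c i b) [3..<Suc n]) \<subseteq> ?S"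
        using c_mem(3) c_mem(1,2)[of 3, simplified] n
        by (simp add: upt image_subset_iff del: upt_Suc)
    qed (use n in auto)
    then show thesis by (elim exE conjE) (rule that)
  qed
  have t_vals: "t 1 = a" "t 2 = b" "\<And>i. i \<in> {3..n} \<Longrightarrow> t i = c i b"
    using t(2) by (auto simp: map_eq_conv)
  have three: "\<alpha> p = conj_perm t p" if "three_cycle ?S p" for p
  proof (rule three_cycle_star_generation[of 1 ?S 2, OF _ _ _ _ _ that])
    show "\<alpha> (cyc3 1 2 i) = conj_perm t (cyc3 1 2 i)" if "i \<in> ?S" "i \<noteq> 1" "i \<noteq> 2" for i
    proof -
      have i: "i \<in> {3..n}" using that by auto
      have "t \<circ> cyc3 1 2 i = c i \<circ> t"
        using permutes_comp_cyc3[OF t(1), of 1 2 i] c_eq[OF i] t_vals i by simp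
      then show ?thesis using conj_perm_eq_iff[OF t(1)] unfolding c_def by metis
    qed
    show "\<alpha> (p \<circ> q) = conj_perm t (p \<circ> q)"
      if "three_cycle ?S p" "three_cycle ?S q" "\<alpha> p = conj_perm t p" "\<alpha> q = conj_perm t q" for p q
      using hom3[OF that(1,2)] that(3,4) conj_perm_comp_right[OF t(1)] by simp
  qed (use n in auto)
  show thesis
  proof (rule that[OF t(1)])
    fix p assume "p permutes ?S" "evenperm p"
    then show "\<alpha> p = conj_perm t p"
    proof (induction rule: evenperm_induct)
      case id
      then show ?case using \<alpha>_id conj_perm_id[OF t(1)] by metis
    next
      case (comp p q)
      then show ?case using hom conj_perm_comp_right[OF t(1)] by metis
    qed (use three in blast)
  qed
qed

section \<open>Recognizing transpositions among the odd involutions\<close>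

lemma transpositions_product_funpow_6:
  "(transpose a b \<circ> transpose c d) ^^ 6 = id"
proof -
  let ?r = "transpose a b \<circ> transpose c d"
  have "?r \<circ> ?r = id \<or> ?r \<circ> ?r \<circ> ?r = id"
  proof (cases "a = b \<or> c = d \<or> {a, b} = {c, d} \<or> {a, b} \<inter> {c, d} = {}")
    case True
    then have "?r \<circ> ?r = id"
      by (auto simp: fun_eq_iff transpose_def doubleton_eq_iff)
    then show ?thesis by blast
  next
    case False
    then have "a \<noteq> b" "c \<noteq> d"
      "(a = c \<and> b \<noteq> d) \<or> (a = d \<and> b \<noteq> c) \<or> (b = c \<and> a \<noteq> d) \<or> (b = d \<and> a \<noteq> c)"
      by (auto simp: doubleton_eq_iff)
    then have "?r \<circ> ?r \<circ> ?r = id"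
      by (auto simp: fun_eq_iff transpose_def)
    then show ?thesis by blast
  qed
  then show ?thesis
  proof
    assume r: "?r \<circ> ?r = id"
    then have "?r ^^ 2 = id" by (simp only: numeral_2_eq_2 funpow.simps comp_id)
    then have "(?r ^^ 2) ^^ 3 = id" by (simp only: id_funpow)
    then show ?thesis by (simp only: funpow_mult) simp
  next
    assume r: "?r \<circ> ?r \<circ> ?r = id"
    then have "?r ^^ 3 = id" by (simp only: numeral_3_eq_3 funpow.simps comp_id comp_assoc)
    then have "(?r ^^ 3) ^^ 2 = id" by (simp only: id_funpow)
    then show ?thesis by (simp only: funpow_mult) simp
  qed
qed

text \<open>Transpositions that do not commute have exactly one point in common.\<close>

lemma noncommuting_transpositions_three_cycle:
  assumes "a \<noteq> b" "c \<noteq> d"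
    "transpose a b \<circ> transpose c d \<noteq> transpose c d \<circ> transpose a b"
    "{a, b, c, d} \<subseteq> S"
  shows "three_cycle S (transpose a b \<circ> transpose c d)"
proof -
  have "\<not> (a = c \<and> b = d)" "\<not> (a = d \<and> b = c)"
    using assms(3) by (auto simp: transpose_commute[of d c])
  moreover have "transpose a b \<circ> transpose c d = transpose c d \<circ> transpose a b"
    if "{a, b} \<inter> {c, d} = {}"
    using that by (auto simp: fun_eq_iff transpose_def)
  then have "{a, b} \<inter> {c, d} \<noteq> {}" using assms(3) by blast
  ultimately consider "a = c" "b \<noteq> d" | "a = d" "b \<noteq> c" | "b = c" "a \<noteq> d" | "b = d" "a \<noteq> c"
    by auto
  then show ?thesis
  proof cases
    case 1
    then have "transpose a b \<circ> transpose c d = cyc3 b a d" by (simp add: cyc3_def transpose_commute)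
    then show ?thesis using 1 assms by (auto intro!: three_cycleI)
  next
    case 2
    then have "transpose a b \<circ> transpose c d = cyc3 b a c" by (simp add: cyc3_def transpose_commute)
    then show ?thesis using 2 assms by (auto intro!: three_cycleI)
  next
    case 3
    then have "transpose a b \<circ> transpose c d = cyc3 a b d" by (simp add: cyc3_def)
    then show ?thesis using 3 assms by (auto intro!: three_cycleI)
  next
    case 4
    then have "transpose a b \<circ> transpose c d = cyc3 a b c" by (simp add: cyc3_def transpose_commute)
    then show ?thesis using 4 assms by (auto intro!: three_cycleI)
  qed
qed

text \<open>An involution with at least two transpositions has a conjugate such that the product of the
  two contains a five-cycle, if there is a fixed point, or two four-cycles, if there are at least
  eight points. The sixth power of such a product is not the identity. What remains are a product
  of two transpositions on four points, which is even, and three transpositions on six points,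
  the image of a transposition under an outer automorphism.\<close>

lemma odd_involution_is_transposition:
  assumes S: "finite S" "card S \<noteq> 6"
    and u: "u permutes S" "u \<circ> u = id" "\<not> evenperm u"
    and six: "\<And>s. s permutes S \<Longrightarrow> (u \<circ> conj_perm s u) ^^ 6 = id"
  obtains a b where "a \<in> S" "b \<in> S" "a \<noteq> b" "u = transpose a b"
proof -
  have uu: "u (u x) = x" for x using fun_cong[OF u(2), of x] by simp
  have inj: "u x = u y \<longleftrightarrow> x = y" for x y using permutes_inj[OF u(1)] by (simp add: inj_eq)
  have mem: "u x \<in> S \<longleftrightarrow> x \<in> S" for x using permutes_in_image[OF u(1)] .
  have moved: "x \<in> S" if "u x \<noteq> x" for x using u(1) that by (metis permutes_not_in)
  have "u \<noteq> id" using u(3) by auto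
  then obtain a where a: "u a \<noteq> a" by fastforce
  define a' where "a' = u a"
  have aS: "a \<in> S" "a' \<in> S" using moved[OF a] by (simp_all add: a'_def mem)
  have ua: "u a = a'" "u a' = a" by (simp_all add: a'_def uu)
  have "u = transpose a a'"
  proof (rule ccontr)
    assume "u \<noteq> transpose a a'"
    then obtain b where b: "u b \<noteq> transpose a a' b" by (meson ext)
    define b' where "b' = u b"
    have ub: "u b = b'" "u b' = b" by (simp_all add: b'_def uu)
    have ab: "distinct [a, a', b, b']"
      using a b ua ub inj[of a b] inj[of a' b] inj[of a b'] by (auto simp: transpose_def split: if_splits)
    have bS: "b \<in> S" "b' \<in> S" using moved[of b] mem[of b] ab ub(1) by auto
    have conj_at: "conj_perm s u (s x) = s (u x)" if "s permutes S" for s x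
      using fun_cong[OF conj_perm_comp[OF that, of u], of x] by simp
    have six_at: "(u \<circ> conj_perm s u) ((u \<circ> conj_perm s u) ((u \<circ> conj_perm s u)
        ((u \<circ> conj_perm s u) ((u \<circ> conj_perm s u) ((u \<circ> conj_perm s u) x))))) = x"
      if "s permutes S" for s x
      using fun_cong[OF six[OF that], of x] by (simp add: eval_nat_numeral)
    show False
    proof (cases "\<exists>e\<in>S. u e = e")
      case True
      then obtain e where e: "e \<in> S" "u e = e" by blast
      then have dist: "distinct [e, a, a', b, b']" using ab ua ub by auto
      \<comment> \<open>The shift makes the conjugate v exchange a' with b and b' with e and fix a.
        Along the path a, a', b, b', e the edges then belong to u and v alternately, so u v is a
        five-cycle there and its sixth power moves e.\<close>
      obtain s where s: "s permutes S" "map s [e, a, a', b, b'] = [a, a', b, b', e]"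
        using permutes_extend[of "[e, a, a', b, b']" "[a, a', b, b', e]" S] dist aS bS e by auto
      define v where "v = conj_perm s u"
      have "v a = a" "v a' = b" "v b = a'" "v b' = e" "v e = b'"
        using conj_at[OF s(1), of e] conj_at[OF s(1), of a] conj_at[OF s(1), of a']
          conj_at[OF s(1), of b] conj_at[OF s(1), of b'] s(2) ua ub e
        by (simp_all add: v_def)
      then show False
        using six_at[OF s(1), of e] dist ua ub e by (auto simp flip: v_def)
    next
      case False
      have "\<exists>c\<in>S. c \<notin> {a, a', b, b'}"
      proof (rule ccontr)
        assume "\<not> ?thesis"
        then have sub: "S \<subseteq> {a, a', b, b'}" by blast
        have "u = transpose a a' \<circ> transpose b b'"
        proof
          fix x show "u x = (transpose a a' \<circ> transpose b b') x"
            using ab ua ub sub moved[of x] by (cases "x \<in> {a, a', b, b'}") auto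
        qed
        then show False using u(3) ab
          by (auto simp: evenperm_comp permutation_swap_id evenperm_swap)
      qed
      then obtain c where c: "c \<in> S" "c \<notin> {a, a', b, b'}" by blast
      define c' where "c' = u c"
      have uc: "u c = c'" "u c' = c" by (simp_all add: c'_def uu)
      have abc: "distinct [a, a', b, b', c, c']"
      proof -
        have "c' \<noteq> c" using False c uc by auto
        then show ?thesis using ab c ua ub uc by auto
      qed
      have cS: "c' \<in> S" using c by (simp add: c'_def mem)
      obtain d where d: "d \<in> S" "d \<notin> {a, a', b, b', c, c'}"
      proof -
        have "card {a, a', b, b', c, c'} = 6" using abc by simp
        then have "S \<noteq> {a, a', b, b', c, c'}" using S(2) by metis
        then show thesis using that aS bS c cS by blast
      qed
      define d' where "d' = u d"
      have ud: "u d = d'" "u d' = d" by (simp_all add: d'_def uu)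
      have dist: "distinct [a, a', b, b', c, c', d, d']"
      proof -
        have "d' \<noteq> d" using False d ud by auto
        then show ?thesis using abc d ua ub uc ud by auto
      qed
      have dS: "d' \<in> S" using d by (simp add: d'_def mem)
      \<comment> \<open>The cyclic shift closes the path to an octagon whose edges belong to u and v
        alternately. On it u v consists of two four-cycles, so its sixth power acts as its square
        and moves a.\<close>
      obtain s where s: "s permutes S"
        "map s [a, a', b, b', c, c', d, d'] = [a', b, b', c, c', d, d', a]"
        using permutes_extend[of "[a, a', b, b', c, c', d, d']" "[a', b, b', c, c', d, d', a]" S]
          dist aS bS c cS d dS by auto
      define v where "v = conj_perm s u"
      have "v a = d'" "v d' = a" "v a' = b" "v b = a'" "v b' = c" "v c = b'" "v c' = d" "v d = c'"
        using conj_at[OF s(1), of a] conj_at[OF s(1), of a'] conj_at[OF s(1), of b]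
          conj_at[OF s(1), of b'] conj_at[OF s(1), of c] conj_at[OF s(1), of c']
          conj_at[OF s(1), of d] conj_at[OF s(1), of d'] s(2) ua ub uc ud
        by (simp_all add: v_def)
      then show False
        using six_at[OF s(1), of a] dist ua ub uc ud by (auto simp flip: v_def)
    qed
  qed
  then show thesis using that aS a ua by metis
qed

lemma permutes_evenperm_comp:
  "finite S \<Longrightarrow> p permutes S \<Longrightarrow> q permutes S \<Longrightarrow>
    evenperm (p \<circ> q) \<longleftrightarrow> (evenperm p \<longleftrightarrow> evenperm q)"
  by (simp add: evenperm_comp permutes_imp_permutation)

text \<open>The quotient \<open>inv' t \<circ> s\<close> commutes with every three-cycle.\<close>

lemma conj_perm_eq_of_three_cycles:
  assumes S: "finite S" "4 \<le> card S" and st: "s permutes S" "t permutes S"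
    and eq: "\<And>c. three_cycle S c \<Longrightarrow> conj_perm s c = conj_perm t c"
  shows "s = t"
proof -
  have ti: "inv' t permutes S" using st(2) by (rule permutes_inv)
  have "inv' t \<circ> s = id"
  proof (rule commute_three_cycles_imp_id[OF S permutes_compose[OF st(1) ti]])
    fix c assume "three_cycle S c"
    then have "conj_perm (inv' t \<circ> s) c = conj_perm (inv' t \<circ> t) c"
      using eq by (simp add: conj_perm_comp_left[OF ti] st)
    also have "\<dots> = c" by (simp add: permutes_inv_o(2)[OF st(2)] conj_perm_def)
    finally show "inv' t \<circ> s \<circ> c = c \<circ> (inv' t \<circ> s)"
      using conj_perm_eq_iff[OF permutes_compose[OF st(1) ti]] by blast
  qed
  then show ?thesis by (metis comp_assoc comp_id id_comp permutes_inv_o(1) st(2))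
qed

section \<open>Automorphisms of the symmetric group\<close>

lemma sym_group_conj: 
  assumes "s permutes {1..n}" "x permutes {1..n}"
  shows "conj_by (sym_group n) s x = conj_perm s x"
  using assms by (simp add: conj_by_def conj_perm_def sym_group_carrier sym_group_mult)

lemma
  assumes "\<psi> \<in> auto (sym_group n)"
  shows sym_auto_permutes: "p permutes {1..n} \<Longrightarrow> \<psi> p permutes {1..n}"
    and sym_auto_comp: "p permutes {1..n} \<Longrightarrow> q permutes {1..n} \<Longrightarrow> \<psi> (p \<circ> q) = \<psi> p \<circ> \<psi> q"
    and sym_auto_inj: "p permutes {1..n} \<Longrightarrow> q permutes {1..n} \<Longrightarrow> \<psi> p = \<psi> q \<longleftrightarrow> p = q"
    and sym_auto_id: "\<psi> id = id"
    and sym_auto_surj: "q permutes {1..n} \<Longrightarrow> \<exists>p. p permutes {1..n} \<and> \<psi> p = q"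
proof -
  interpret G: group "sym_group n" by (rule sym_group_is_group)
  show "\<psi> p permutes {1..n}" if "p permutes {1..n}"
    using G.auto_closed[OF assms] that by (simp add: sym_group_carrier)
  show "\<psi> (p \<circ> q) = \<psi> p \<circ> \<psi> q" if "p permutes {1..n}" "q permutes {1..n}"
    using G.auto_mult[OF assms] that by (simp only: sym_group_carrier sym_group_mult)
  show "\<psi> p = \<psi> q \<longleftrightarrow> p = q" if "p permutes {1..n}" "q permutes {1..n}"
    using G.auto_inj[OF assms] that by (simp add: sym_group_carrier)
  show "\<psi> id = id"
    using group_hom.hom_one[OF G.auto_group_hom[OF assms]] by (simp only: sym_group_one)
  show "\<exists>p. p permutes {1..n} \<and> \<psi> p = q" if "q permutes {1..n}"
  proof -
    have "q \<in> \<psi> ` carrier (sym_group n)"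
      using G.auto_bij_betw[OF assms] that by (simp add: bij_betw_def sym_group_carrier)
    then show ?thesis by (auto simp: sym_group_carrier)
  qed
qed

lemma sym_auto_conj_perm:
  assumes \<psi>: "\<psi> \<in> auto (sym_group n)" and "s permutes {1..n}" "x permutes {1..n}"
  shows "\<psi> (conj_perm s x) = conj_perm (\<psi> s) (\<psi> x)"
proof -
  have "\<psi> s \<circ> \<psi> x = \<psi> (conj_perm s x) \<circ> \<psi> s"
    using assms conj_perm_comp[OF assms(2), of x] conj_perm_permutes[OF assms(2,3)]
    by (metis sym_auto_comp)
  then show ?thesis
    using conj_perm_eq_iff[OF sym_auto_permutes[OF \<psi> assms(2)]] by metis
qed

lemma sym_auto_funpow:
  assumes \<psi>: "\<psi> \<in> auto (sym_group n)" and p: "p permutes {1..n}"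
  shows "\<psi> (p ^^ k) = \<psi> p ^^ k"
proof (induction k)
  case 0
  show ?case using sym_auto_id[OF \<psi>] by (simp only: funpow.simps)
next
  case (Suc k)
  have "p ^^ k permutes {1..n}"
    by (induction k) (simp_all only: funpow.simps permutes_id permutes_compose[OF _ p])
  then show ?case using Suc sym_auto_comp[OF \<psi> p] by (simp only: funpow.simps)
qed

text \<open>A three-cycle c is a square, c = (c c)(c c); automorphisms preserve squares, and every
  square is even.\<close>

lemma sym_auto_even:
  assumes \<psi>: "\<psi> \<in> auto (sym_group n)" and p: "p permutes {1..n}" "evenperm p"
  shows "evenperm (\<psi> p)"
  using p
proof (induction rule: evenperm_induct)
  case id
  show ?case using sym_auto_id[OF \<psi>] evenperm_id by metis
next
  case (cycle c)
  note c = three_cycle_permutes[OF cycle]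
  have cc: "c \<circ> c permutes {1..n}" using c by (rule permutes_compose[OF c])
  have "c = (c \<circ> c) \<circ> (c \<circ> c)"
    using three_cycle_cube[OF cycle] by (metis comp_assoc comp_id)
  then have "\<psi> c = \<psi> (c \<circ> c) \<circ> \<psi> (c \<circ> c)" using sym_auto_comp[OF \<psi> cc cc] by metis
  then show ?case
    by (metis permutes_evenperm_comp finite_atLeastAtMost sym_auto_permutes[OF \<psi> cc])
next
  case (comp p q)
  then show ?case
    using sym_auto_comp[OF \<psi>] sym_auto_permutes[OF \<psi>] permutes_evenperm_comp[of "{1..n}"]
    by (metis finite_atLeastAtMost)
qed

lemma finite_even_permutes: "finite {p. p permutes {1..n::nat} \<and> evenperm p}"
  by (rule finite_subset[OF _ finite_permutations[of "{1..n}"]]) auto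

lemma sym_auto_even_surj:
  assumes \<psi>: "\<psi> \<in> auto (sym_group n)" and q: "q permutes {1..n}" "evenperm q"
  obtains p where "p permutes {1..n}" "evenperm p" "\<psi> p = q"
proof -
  let ?A = "{p. p permutes {1..n} \<and> evenperm p}"
  have "\<psi> ` ?A = ?A"
  proof (rule endo_inj_surj[OF finite_even_permutes])
    show "\<psi> ` ?A \<subseteq> ?A" using sym_auto_even[OF \<psi>] sym_auto_permutes[OF \<psi>] by auto
    show "inj_on \<psi> ?A" using sym_auto_inj[OF \<psi>] by (auto intro: inj_onI)
  qed
  then have "q \<in> \<psi> ` ?A" using q by simp
  then show thesis using that by auto
qed

lemma sym_auto_even_iff:
  assumes \<psi>: "\<psi> \<in> auto (sym_group n)" and p: "p permutes {1..n}"
  shows "evenperm (\<psi> p) \<longleftrightarrow> evenperm p"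
proof
  assume "evenperm (\<psi> p)"
  then obtain q where "q permutes {1..n}" "evenperm q" "\<psi> q = \<psi> p"
    using sym_auto_even_surj[OF \<psi> sym_auto_permutes[OF \<psi> p]] by metis
  then show "evenperm p" using sym_auto_inj[OF \<psi> _ p] by blast
qed (rule sym_auto_even[OF \<psi> p])

text \<open>Both images of s conjugate the common image of an even x in the same way, and these
  common images include all three-cycles.\<close>

lemma sym_auto_eqI:
  assumes n: "4 \<le> n" and \<psi>: "\<psi> \<in> auto (sym_group n)" and \<phi>: "\<phi> \<in> auto (sym_group n)"
    and eq: "\<And>p. p permutes {1..n} \<Longrightarrow> evenperm p \<Longrightarrow> \<psi> p = \<phi> p"
    and s: "s permutes {1..n}"
  shows "\<psi> s = \<phi> s"
proof (rule conj_perm_eq_of_three_cycles[of "{1..n}"])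
  fix c assume c: "three_cycle {1..n} c"
  then obtain x where x: "x permutes {1..n}" "evenperm x" "\<psi> x = c"
    using sym_auto_even_surj[OF \<psi> three_cycle_permutes three_cycle_even] by metis
  have "conj_perm (\<psi> s) (\<psi> x) = \<psi> (conj_perm s x)"
    using sym_auto_conj_perm[OF \<psi> s x(1)] by simp
  also have "\<dots> = \<phi> (conj_perm s x)"
    using conj_perm_permutes[OF s x(1)] evenperm_conj_perm[OF _ s x(1)] x(2) eq by simp
  also have "\<dots> = conj_perm (\<phi> s) (\<phi> x)"
    using sym_auto_conj_perm[OF \<phi> s x(1)] by simp
  also have "\<phi> x = \<psi> x" using eq x by simp
  finally show "conj_perm (\<psi> s) c = conj_perm (\<phi> s) c" by (simp add: x(3))
qed (use n s sym_auto_permutes \<psi> \<phi> in auto)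

lemma sym_auto_transposition:
  assumes n: "n \<noteq> 6" and \<psi>: "\<psi> \<in> auto (sym_group n)"
    and ab: "a \<in> {1..n}" "b \<in> {1..n}" "a \<noteq> b"
  obtains c d where "c \<in> {1..n}" "d \<in> {1..n}" "c \<noteq> d" "\<psi> (transpose a b) = transpose c d"
proof (rule odd_involution_is_transposition[of "{1..n}" "\<psi> (transpose a b)"])
  let ?t = "transpose a b"
  have t: "?t permutes {1..n}" using ab by (intro permutes_swap_id)
  show "\<psi> ?t permutes {1..n}" using sym_auto_permutes[OF \<psi> t] .
  show "\<psi> ?t \<circ> \<psi> ?t = id"
    using sym_auto_comp[OF \<psi> t t] sym_auto_id[OF \<psi>] by simp
  show "\<not> evenperm (\<psi> ?t)" using sym_auto_even_iff[OF \<psi> t] ab by (simp add: evenperm_swap)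
  fix s assume "s permutes {1..n}"
  \<comment> \<open>Surjectivity makes every conjugate of the image the image of a conjugate
    transposition, so the bound on products of two transpositions carries over.\<close>
  then obtain r where r: "r permutes {1..n}" "\<psi> r = s" using sym_auto_surj[OF \<psi>] by blast
  let ?t' = "transpose (r a) (r b)"
  have t': "?t' permutes {1..n}" 
    using ab by (intro permutes_swap_id) (simp_all only: permutes_in_image[OF r(1)])
  have "conj_perm r ?t = ?t'"
    using conj_perm_eq_iff[OF r(1)] permutes_comp_transpose[OF r(1)] by blast
  then have "conj_perm s (\<psi> ?t) = \<psi> ?t'"
    using sym_auto_conj_perm[OF \<psi> r(1) t] r(2) by simp
  then have "(\<psi> ?t \<circ> conj_perm s (\<psi> ?t)) ^^ 6 = \<psi> ((?t \<circ> ?t') ^^ 6)"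
    using sym_auto_funpow[OF \<psi> permutes_compose[OF t' t]] sym_auto_comp[OF \<psi> t t'] by simp
  then show "(\<psi> ?t \<circ> conj_perm s (\<psi> ?t)) ^^ 6 = id"
    by (simp only: transpositions_product_funpow_6 sym_auto_id[OF \<psi>])
qed (use n that in auto)

text \<open>A three-cycle is a product of two transpositions that do not commute, and injectivity
  keeps their images from commuting.\<close>

lemma sym_auto_three_cycle:
  assumes n: "n \<noteq> 6" and \<psi>: "\<psi> \<in> auto (sym_group n)" and x: "three_cycle {1..n} x"
  shows "three_cycle {1..n} (\<psi> x)"
proof -
  obtain a b c where abc: "distinct [a, b, c]" "{a, b, c} \<subseteq> {1..n}" "x = cyc3 a b c"
    using x by (auto simp: three_cycle_def)
  have ab: "a \<in> {1..n}" "b \<in> {1..n}" "a \<noteq> b" and bc: "b \<in> {1..n}" "c \<in> {1..n}" "b \<noteq> c"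
    using abc by auto
  obtain d e where de: "d \<in> {1..n}" "e \<in> {1..n}" "d \<noteq> e" "\<psi> (transpose a b) = transpose d e"
    using sym_auto_transposition[OF n \<psi> ab] .
  obtain f g where fg: "f \<in> {1..n}" "g \<in> {1..n}" "f \<noteq> g" "\<psi> (transpose b c) = transpose f g"
    using sym_auto_transposition[OF n \<psi> bc] .
  have t: "transpose a b permutes {1..n}" "transpose b c permutes {1..n}"
    using ab bc by (intro permutes_swap_id; simp)+
  have "(transpose a b \<circ> transpose b c) a \<noteq> (transpose b c \<circ> transpose a b) a" using abc by auto
  then have "transpose a b \<circ> transpose b c \<noteq> transpose b c \<circ> transpose a b" by metis
  then have "transpose d e \<circ> transpose f g \<noteq> transpose f g \<circ> transpose d e"
    using sym_auto_comp[OF \<psi>] sym_auto_inj[OF \<psi>] t permutes_compose de(4) fg(4) by metis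
  then have "three_cycle {1..n} (transpose d e \<circ> transpose f g)"
    using de fg by (intro noncommuting_transpositions_three_cycle) auto
  then show ?thesis
    using sym_auto_comp[OF \<psi> t] de(4) fg(4) by (simp add: abc(3) cyc3_def)
qed

text \<open>For n = 3 this leaves room to alter a conjugator by an even permutation without changing
  its action on A_3.\<close>

lemma even_permutes_3_commute:
  assumes "p permutes {1..3::nat}" "evenperm p" "q permutes {1..3}" "evenperm q"
  shows "p \<circ> q = q \<circ> p"
proof -
  have cc: "c \<circ> d = d \<circ> c" if "three_cycle {1..3::nat} c" "three_cycle {1..3::nat} d" for c d
  proof -
    have "c = cyc3 1 2 3 \<or> c = cyc3 1 3 2" if c: "three_cycle {1..3::nat} c" for c
    proof -
      obtain x y z where xyz: "distinct [x, y, z]" "{x, y, z} \<subseteq> {1..3::nat}" "c = cyc3 x y z"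
        using c by (auto simp: three_cycle_def)
      have "{x, y, z} = {1..3}" by (rule card_subset_eq) (use xyz in auto)
      then have "1 \<in> {x, y, z}" by simp
      then have "c 1 \<noteq> 1" using xyz(1,3) by (auto simp: cyc3_apply)
      then have eq: "c = cyc3 1 (c 1) (c (c 1))" and dist: "distinct [1, c 1, c (c 1)]"
        using three_cycle_at[OF c] three_cycle_distinct[OF c] by blast+
      have "c 1 \<in> {1..3}" "c (c 1) \<in> {1..3}"
        using permutes_in_image[OF three_cycle_permutes[OF c]] by auto
      then have "(c 1 = 2 \<and> c (c 1) = 3) \<or> (c 1 = 3 \<and> c (c 1) = 2)"
        using dist unfolding atLeastAtMost_iff distinct.simps by (simp, linarith)
      then show ?thesis using eq by metis
    qed
    then have "c \<in> {cyc3 1 2 3, cyc3 1 3 2}" "d \<in> {cyc3 1 2 3, cyc3 1 3 2}" using that by auto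
    then show ?thesis by (auto simp: fun_eq_iff cyc3_apply)
  qed
  have cq: "c \<circ> q = q \<circ> c" if "three_cycle {1..3::nat} c" for c
    using assms(3,4)
  proof (induction rule: evenperm_induct)
    case (comp p q)
    then show ?case by (metis comp_assoc)
  qed (use cc that in simp_all)
  show ?thesis
    using assms(1,2)
  proof (induction rule: evenperm_induct)
    case (comp p' q')
    then show ?case by (metis comp_assoc)
  qed (use cq in simp_all)
qed

theorem sym_auto_inner:
  assumes n: "3 \<le> n" "n \<noteq> 6" and \<psi>: "\<psi> \<in> auto (sym_group n)"
  obtains t where "t permutes {1..n}" "\<psi> = conj_by (sym_group n) t"
proof -
  interpret G: group "sym_group n" by (rule sym_group_is_group)
  have "\<exists>t. t permutes {1..n} \<and> (\<forall>p. p permutes {1..n} \<longrightarrow> \<psi> p = conj_perm t p)"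
  proof -
    have "inj_on \<psi> {p. p permutes {1..n} \<and> evenperm p}"
      using sym_auto_inj[OF \<psi>] by (auto intro: inj_onI)
    then obtain t where t: "t permutes {1..n}"
      "\<And>p. p permutes {1..n} \<Longrightarrow> evenperm p \<Longrightarrow> \<psi> p = conj_perm t p"
      using three_cycle_preserving_is_conjugation[OF n(1), of \<psi>] sym_auto_comp[OF \<psi>]
        sym_auto_three_cycle[OF n(2) \<psi>] by blast
    show ?thesis
    proof (cases "n = 3")
      case False
      have ct: "conj_by (sym_group n) t \<in> auto (sym_group n)"
        using t(1) by (intro G.conj_by_auto) (simp add: sym_group_carrier)
      have "\<psi> p = conj_perm t p" if "p permutes {1..n}" for p
        using sym_auto_eqI[OF _ \<psi> ct _ that] t n False that by (simp add: sym_group_conj)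
      then show ?thesis using t(1) by blast
    next
      case True
      let ?t = "transpose 1 2 :: nat \<Rightarrow> nat"
      have tt: "?t permutes {1..n}" "\<not> evenperm ?t"
        using True by (auto intro!: permutes_swap_id simp: evenperm_swap)
      obtain c d where cd: "c \<in> {1..n}" "d \<in> {1..n}" "c \<noteq> d" "\<psi> ?t = transpose c d"
        using sym_auto_transposition[OF n(2) \<psi>, of 1 2] True by auto
      define a b where "a = t 1" and "b = t 2"
      have ab: "a \<in> {1..n}" "b \<in> {1..n}" "a \<noteq> b"
        using permutes_in_image[OF t(1)] permutes_inj[OF t(1)] True
        by (auto simp: a_def b_def inj_eq)
      have conj_t: "conj_perm t ?t = transpose a b"
        using conj_perm_eq_iff[OF t(1)] permutes_comp_transpose[OF t(1)] unfolding a_def b_def by blast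
      \<comment> \<open>On three points two transpositions are equal or satisfy the braid relation,
        so this even permutation conjugates (a b) to (c d). It corrects t at one odd element and
        leaves the values on A_3 as they are.\<close>
      define r where "r = transpose a b \<circ> transpose c d"
      have r: "r permutes {1..n}" unfolding r_def
        using ab cd by (intro permutes_compose permutes_swap_id)
      have r_even: "evenperm r"
        using ab cd by (simp add: r_def evenperm_comp permutation_swap_id evenperm_swap)
      have "a \<in> {1, 2, 3}" "b \<in> {1, 2, 3}" "c \<in> {1, 2, 3}" "d \<in> {1, 2, 3}" using True ab cd by auto
      then have "r \<circ> transpose a b = transpose c d \<circ> r"
        using ab(3) cd(3) by (auto simp: r_def fun_eq_iff transpose_def)
      then have conj_r: "conj_perm r (transpose a b) = transpose c d"
        using conj_perm_eq_iff[OF r] by blast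
      define s where "s = r \<circ> t"
      have s: "s permutes {1..n}" unfolding s_def using t(1) r by (rule permutes_compose)
      have s_t: "\<psi> ?t = conj_perm s ?t"
        unfolding s_def conj_perm_comp_left[OF r t(1)] conj_t conj_r by (rule cd(4))
      have s_even: "\<psi> p = conj_perm s p" if p: "p permutes {1..n}" "evenperm p" for p
      proof -
        have "conj_perm r (\<psi> p) = \<psi> p"
          using even_permutes_3_commute[of r "\<psi> p"] r r_even sym_auto_permutes[OF \<psi> p(1)]
            sym_auto_even[OF \<psi> p] conj_perm_eq_iff[OF r] True by simp
        then show ?thesis by (simp add: s_def conj_perm_comp_left[OF r t(1)] t(2)[OF p])
      qed
      have "\<psi> p = conj_perm s p" if p: "p permutes {1..n}" for p
      proof (cases "evenperm p")
        case False
        \<comment> \<open>An odd p is the even p (1 2) times (1 2), and \<open>s\<close> is already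
          correct on both factors.\<close>
        have pt: "p \<circ> ?t permutes {1..n}" using tt(1) p by (rule permutes_compose)
        have "evenperm (p \<circ> ?t)" using permutes_evenperm_comp[OF _ p tt(1)] tt(2) False by simp
        then have "\<psi> (p \<circ> ?t \<circ> ?t) = conj_perm s (p \<circ> ?t \<circ> ?t)"
          using sym_auto_comp[OF \<psi> pt tt(1)] conj_perm_comp_right[OF s] s_even[OF pt] s_t by simp
        then show ?thesis by (simp add: comp_assoc)
      qed (rule s_even[OF p])
      then show ?thesis using s by blast
    qed
  qed
  then obtain t where t: "t permutes {1..n}" "\<And>p. p permutes {1..n} \<Longrightarrow> \<psi> p = conj_perm t p"
    by blast
  have "\<psi> = conj_by (sym_group n) t"
    using t by (intro G.auto_eqI \<psi> G.conj_by_auto) (simp_all add: sym_group_carrier sym_group_conj)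
  then show thesis using that t(1) by blast
qed

lemma sym_group_centre:
  assumes n: "3 \<le> n" and z: "z \<in> carrier (sym_group n)"
    and comm: "\<And>x. x \<in> carrier (sym_group n) \<Longrightarrow> z \<otimes>\<^bsub>sym_group n\<^esub> x = x \<otimes>\<^bsub>sym_group n\<^esub> z"
  shows "z = \<one>\<^bsub>sym_group n\<^esub>"
  unfolding sym_group_one
proof (rule commute_transpositions_imp_id[of "{1..n}"])
  show "z \<circ> transpose a b = transpose a b \<circ> z" if "a \<in> {1..n}" "b \<in> {1..n}" for a b
    using comm[of "transpose a b"] that permutes_swap_id[OF that]
    by (simp add: sym_group_mult sym_group_carrier)
qed (use n z in \<open>auto simp: sym_group_carrier\<close>)

section \<open>At least five points\<close>

text \<open>Every element of order three commutes with an odd permutation, so conjugating it by any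
  permutation gives a conjugate within the alternating group. Hence transporting conjugation by a
  permutation along an automorphism of the alternating group preserves three-cycles, even if the
  automorphism does not.\<close>

theorem alternating_auto_extends:
  fixes n :: nat
  assumes n: "5 \<le> n"
    and hom: "\<And>p q. p permutes {1..n} \<Longrightarrow> evenperm p \<Longrightarrow> q permutes {1..n} \<Longrightarrow> evenperm q \<Longrightarrow>
      \<alpha> (p \<circ> q) = \<alpha> p \<circ> \<alpha> q"
    and inj: "inj_on \<alpha> {p. p permutes {1..n} \<and> evenperm p}"
    and closed: "\<alpha> ` {p. p permutes {1..n} \<and> evenperm p} \<subseteq> {p. p permutes {1..n} \<and> evenperm p}"
  obtains F where "F \<in> auto (sym_group n)"
    "\<And>p. p permutes {1..n} \<Longrightarrow> evenperm p \<Longrightarrow> F p = \<alpha> p"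
proof -
  interpret G: group "sym_group n" by (rule sym_group_is_group)
  define E where "E = {p. p permutes {1..n} \<and> evenperm p}"
  have E_comp: "p \<circ> q \<in> E" if "p \<in> E" "q \<in> E" for p q
    using that permutes_compose[of q _ p] permutes_evenperm_comp[of "{1..n}" p q]
    by (simp add: E_def)
  have E_conj: "conj_perm s p \<in> E" if "s permutes {1..n}" "p \<in> E" for s p
    using that conj_perm_permutes[of s _ p] evenperm_conj_perm[of "{1..n}" s p] by (simp add: E_def)
  have E_id: "id \<in> E" using permutes_id evenperm_id unfolding E_def by blast
  have hom: "\<alpha> (p \<circ> q) = \<alpha> p \<circ> \<alpha> q" if "p \<in> E" "q \<in> E" for p q
    using hom that by (simp add: E_def)
  have inj: "\<alpha> p = \<alpha> q \<longleftrightarrow> p = q" if "p \<in> E" "q \<in> E" for p q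
    using inj that unfolding E_def[symmetric] by (auto dest: inj_onD)
  have closed: "\<alpha> p \<in> E" if "p \<in> E" for p
    using closed that unfolding E_def[symmetric] by blast
  have surj: "\<alpha> ` E = E"
  proof (rule endo_inj_surj)
    show "finite E" unfolding E_def by (rule finite_even_permutes)
  qed (use closed inj in \<open>auto intro: inj_onI\<close>)
  define \<beta> where "\<beta> = inv_into E \<alpha>"
  have \<beta>: "\<beta> y \<in> E" "\<alpha> (\<beta> y) = y" if "y \<in> E" for y
    using that surj by (metis \<beta>_def inv_into_into f_inv_into_f)+
  have \<beta>_\<alpha>: "\<beta> (\<alpha> x) = x" if "x \<in> E" for x
    using \<beta>[OF closed[OF that]] inj that by blast
  have \<beta>_comp: "\<beta> (p \<circ> q) = \<beta> p \<circ> \<beta> q" if "p \<in> E" "q \<in> E" for p q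
    using inj[OF \<beta>(1)[OF E_comp[OF that]] E_comp[OF \<beta>(1) \<beta>(1)], OF that]
      hom[OF \<beta>(1) \<beta>(1), OF that] \<beta>(2) E_comp that by simp
  have \<alpha>_id: "\<alpha> id = id"
  proof -
    have "\<beta> id \<circ> \<beta> id = \<beta> id" using \<beta>_comp[OF E_id E_id] by simp
    moreover have "\<beta> id permutes {1..n}" using \<beta>(1)[OF E_id] by (simp add: E_def)
    ultimately have "\<beta> id = id" by (metis comp_assoc id_comp permutes_inv_o(2))
    then show ?thesis using \<beta>(2)[OF E_id] by metis
  qed
  \<comment> \<open>The graph of the extension: t acts on A_n as s does, seen through \<alpha>.
    Totality, uniqueness, multiplicativity and injectivity are shown for this relation before a
    function is chosen from it.\<close>
  define R where "R = (\<lambda>s t. t permutes {1..n} \<and> (\<forall>x\<in>E. \<alpha> (conj_perm s x) = conj_perm t (\<alpha> x)))"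
  have R_ex: "\<exists>t. R s t" if s: "s permutes {1..n}" for s
  proof -
    \<comment> \<open>Conjugation by s transported along \<alpha>, with \<beta> the inverse of
      \<alpha> on A_n.\<close>
    define \<gamma> where "\<gamma> = (\<lambda>y. \<alpha> (conj_perm s (\<beta> y)))"
    obtain t where t: "t permutes {1..n}"
      "\<And>y. y permutes {1..n} \<Longrightarrow> evenperm y \<Longrightarrow> \<gamma> y = conj_perm t y"
    proof (rule three_cycle_preserving_is_conjugation[of n \<gamma>])
      show "3 \<le> n" using n by simp
      show "\<gamma> (p \<circ> q) = \<gamma> p \<circ> \<gamma> q"
        if "p permutes {1..n}" "evenperm p" "q permutes {1..n}" "evenperm q" for p q
      proof -
        have pq: "p \<in> E" "q \<in> E" using that by (simp_all add: E_def)
        show ?thesis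
          unfolding \<gamma>_def \<beta>_comp[OF pq] conj_perm_comp_right[OF s]
          by (rule hom) (use pq s \<beta>(1) E_conj in blast)+
      qed
      show "inj_on \<gamma> {p. p permutes {1..n} \<and> evenperm p}"
      proof (rule inj_onI, fold E_def)
        fix p q assume pq: "p \<in> E" "q \<in> E" and "\<gamma> p = \<gamma> q"
        then have "conj_perm s (\<beta> p) = conj_perm s (\<beta> q)"
          using inj E_conj[OF s] \<beta>(1) unfolding \<gamma>_def by blast
        then have "\<beta> p = \<beta> q" using conj_perm_inj[OF s] by blast
        then show "p = q" using \<beta>(2) pq by metis
      qed
      fix c assume c: "three_cycle {1..n} c"
      then have cE: "c \<in> E" using three_cycle_permutes three_cycle_even by (auto simp: E_def)
      \<comment> \<open>Pulling c back keeps only its order: y need not be a three-cycle, but order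
        three suffices for an odd u that commutes with y.\<close>
      define y where "y = \<beta> c"
      have y: "y \<in> E" "\<alpha> y = c" using \<beta>[OF cE] by (simp_all add: y_def)
      have "\<alpha> (y \<circ> y \<circ> y) = \<alpha> id"
        using hom[OF E_comp[OF y(1) y(1)] y(1)] hom[OF y(1) y(1)] three_cycle_cube[OF c] \<alpha>_id
        by (simp add: y(2))
      then have y3: "y \<circ> y \<circ> y = id" using inj E_comp y(1) E_id by blast
      have y_id: "y \<noteq> id" using y(2) \<alpha>_id three_cycle_neq_id[OF c] by metis
      have yp: "y permutes {1..n}" using y(1) by (simp add: E_def)
      obtain u where u: "u permutes {1..n}" "\<not> evenperm u" "conj_perm u y = y"
        using order_three_commutes_odd[OF _ _ yp y3 y_id] n by auto
      \<comment> \<open>Replacing an odd s by s u leaves the conjugate of y unchanged and makes the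
        conjugator even, hence an argument to which \<alpha> applies as a homomorphism.\<close>
      obtain w where w: "w \<in> E" "conj_perm s y = conj_perm w y"
      proof (cases "evenperm s")
        case True
        then show thesis using that[of s] s by (simp add: E_def)
      next
        case False
        have "s \<circ> u \<in> E"
          using permutes_compose[OF u(1) s] permutes_evenperm_comp[OF _ s u(1)] False u(2)
          by (simp add: E_def)
        moreover have "conj_perm (s \<circ> u) y = conj_perm s y"
          by (simp add: conj_perm_comp_left[OF s u(1)] u(3))
        ultimately show thesis using that by metis
      qed
      have wp: "w permutes {1..n}" and \<alpha>wp: "\<alpha> w permutes {1..n}"
        using w(1) closed by (auto simp: E_def)
      have "\<alpha> w \<circ> \<alpha> y = \<alpha> (conj_perm w y) \<circ> \<alpha> w"
        using hom[OF w(1) y(1)] hom[OF E_conj[OF wp y(1)] w(1)] conj_perm_comp[OF wp, of y] by metis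
      then have "\<alpha> (conj_perm w y) = conj_perm (\<alpha> w) c"
        using conj_perm_eq_iff[OF \<alpha>wp] y(2) by metis
      then show "three_cycle {1..n} (\<gamma> c)"
        using conj_perm_three_cycle[OF \<alpha>wp c] w(2) by (simp add: \<gamma>_def flip: y_def)
    qed (rule that)
    have "R s t"
      unfolding R_def
    proof (intro conjI t(1) ballI)
      fix x assume x: "x \<in> E"
      have "\<gamma> (\<alpha> x) = conj_perm t (\<alpha> x)" using t(2) closed[OF x] by (simp add: E_def)
      then show "\<alpha> (conj_perm s x) = conj_perm t (\<alpha> x)" by (simp add: \<gamma>_def \<beta>_\<alpha>[OF x])
    qed
    then show ?thesis by blast
  qed
  have R_unique: "t = t'" if "R s t" "R s t'" for s t t'
  proof (rule conj_perm_eq_of_three_cycles[of "{1..n}"])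
    fix c assume c: "three_cycle {1..n} c"
    then have "c \<in> E" using three_cycle_permutes three_cycle_even by (auto simp: E_def)
    then obtain x where "x \<in> E" "\<alpha> x = c" using \<beta> by blast
    then show "conj_perm t c = conj_perm t' c" using that unfolding R_def by metis
  qed (use n that in \<open>auto simp: R_def\<close>)
  have R_comp: "R (s \<circ> s') (t \<circ> t')"
    if "s permutes {1..n}" "s' permutes {1..n}" "R s t" "R s' t'" for s s' t t'
    unfolding R_def
  proof (intro conjI ballI)
    have t: "t permutes {1..n}" "t' permutes {1..n}" using that by (simp_all add: R_def)
    then show "t \<circ> t' permutes {1..n}" by (intro permutes_compose)
    fix x assume x: "x \<in> E"
    have "\<alpha> (conj_perm s (conj_perm s' x)) = conj_perm t (\<alpha> (conj_perm s' x))"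
      using that(3) E_conj[OF that(2) x] by (simp add: R_def)
    also have "\<alpha> (conj_perm s' x) = conj_perm t' (\<alpha> x)" using that(4) x by (simp add: R_def)
    finally show "\<alpha> (conj_perm (s \<circ> s') x) = conj_perm (t \<circ> t') (\<alpha> x)"
      by (simp add: conj_perm_comp_left[OF that(1,2)] conj_perm_comp_left[OF t])
  qed
  \<comment> \<open>With uniqueness this says that the function chosen from \<open>R\<close> extends
    \<alpha>.\<close>
  have R_even: "R s (\<alpha> s)" if s: "s \<in> E" for s
    unfolding R_def
  proof (intro conjI ballI)
    show \<alpha>s: "\<alpha> s permutes {1..n}" using closed[OF s] by (simp add: E_def)
    fix x assume x: "x \<in> E"
    have sp: "s permutes {1..n}" using s by (simp add: E_def)
    have "\<alpha> s \<circ> \<alpha> x = \<alpha> (conj_perm s x) \<circ> \<alpha> s"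
      using hom[OF s x] hom[OF E_conj[OF sp x] s] conj_perm_comp[OF sp, of x] by metis
    then show "\<alpha> (conj_perm s x) = conj_perm (\<alpha> s) (\<alpha> x)"
      using conj_perm_eq_iff[OF \<alpha>s] by metis
  qed
  have R_inj: "s = s'" if "R s t" "R s' t" "s permutes {1..n}" "s' permutes {1..n}" for s s' t
  proof (rule conj_perm_eq_of_three_cycles[of "{1..n}"])
    fix c assume c: "three_cycle {1..n} c"
    then have c: "c \<in> E" using three_cycle_permutes three_cycle_even by (auto simp: E_def)
    then have "\<alpha> (conj_perm s c) = \<alpha> (conj_perm s' c)" using that unfolding R_def by metis
    then show "conj_perm s c = conj_perm s' c" using inj E_conj that c by blast
  qed (use n that in auto)
  define F where "F = (\<lambda>s. SOME t. R s t)"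
  have F: "R s (F s)" if "s permutes {1..n}" for s
    unfolding F_def by (rule someI_ex[OF R_ex[OF that]])
  have F_permutes: "F s permutes {1..n}" if "s permutes {1..n}" for s
    using F[OF that] by (simp add: R_def)
  have F_inj: "inj_on F (carrier (sym_group n))"
  proof (rule inj_onI, unfold sym_group_carrier)
    fix s s' assume ss: "s permutes {1..n}" "s' permutes {1..n}" "F s = F s'"
    then have "R s (F s)" "R s' (F s)" using F by metis+
    then show "s = s'" using R_inj ss(1,2) by blast
  qed
  have "restrict F (carrier (sym_group n)) \<in> auto (sym_group n)"
  proof (rule G.autoI)
    show "F x \<in> carrier (sym_group n)" if "x \<in> carrier (sym_group n)" for x
      using that F_permutes by (simp only: sym_group_carrier)
    show "F (x \<otimes>\<^bsub>sym_group n\<^esub> y) = F x \<otimes>\<^bsub>sym_group n\<^esub> F y"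
      if "x \<in> carrier (sym_group n)" "y \<in> carrier (sym_group n)" for x y
      using that unfolding sym_group_carrier sym_group_mult
      by (meson F R_comp R_unique permutes_compose)
    have "finite (carrier (sym_group n))"
      using finite_permutations[of "{1..n}"] by (simp add: sym_group_def)
    then have "F ` carrier (sym_group n) = carrier (sym_group n)"
      using F_inj F_permutes by (intro endo_inj_surj) (auto simp: sym_group_carrier)
    then show "carrier (sym_group n) \<subseteq> F ` carrier (sym_group n)" by simp
  qed (rule F_inj)
  moreover have "restrict F (carrier (sym_group n)) p = \<alpha> p" if "p permutes {1..n}" "evenperm p" for p
    using R_unique[OF F[OF that(1)] R_even] that by (simp add: E_def sym_group_carrier)
  ultimately show thesis using that by blast
qed

theorem alexander_iso_conjugate_large:
  assumes n: "5 \<le> n" and iso: "pointed_alexander_iso (sym_group n) \<psi> \<phi> f"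
  shows "group.auto_conjugate (sym_group n) \<psi> \<phi>"
proof -
  interpret pointed_alexander_iso "sym_group n" \<psi> \<phi> f by (rule iso)
  let ?G = "sym_group n"
  show ?thesis
  \<comment> \<open>For the identity automorphism the displacement group is trivial and gives no
    hold on f, but the intertwining relation makes \<phi> the identity as well.\<close>
  proof (cases "\<forall>x\<in>carrier ?G. \<psi> x = x")
    case True
    have "\<phi> y = y" if "y \<in> carrier ?G" for y
    proof -
      have "y \<in> f ` carrier ?G" using that bij_betw_imp_surj_on[OF bij] by simp
      then obtain x where x: "x \<in> carrier ?G" "y = f x" by (rule imageE) (rule that)
      then show ?thesis using f_intertwines[OF x(1)] True by simp
    qed
    then show ?thesis
      unfolding auto_conjugate_def using True id_in_auto
      by (intro bexI[of _ "\<lambda>x\<in>carrier ?G. x"]) simp_all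
  next
    case False
    then obtain g where g: "g \<in> carrier ?G" "\<psi> g \<noteq> g" by blast
    let ?D = "displacement_group \<psi>"
    interpret D: normal ?D ?G using normal_displacement_group[OF \<psi>] .
    have D_g: "g \<otimes>\<^bsub>?G\<^esub> inv\<^bsub>?G\<^esub> \<psi> g \<in> ?D"
      by (rule displacement_mem[OF \<psi> g(1)])
    have three: "c \<in> ?D" if "three_cycle {1..n} c" for c
    proof (rule conj_closed_contains_three_cycles[OF _ _ _ _ _ _ D_g _ that])
      show "p permutes {1..n}" if "p \<in> ?D" for p
        using D.subset that by (auto simp: sym_group_carrier)
      show "p \<circ> q \<in> ?D" if "p \<in> ?D" "q \<in> ?D" for p q
        using D.m_closed[OF that] by (simp add: sym_group_mult)
      show "inv' p \<in> ?D" if "p \<in> ?D" for p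
        using D.m_inv_closed[OF that] D.subset that by auto
      show "conj_perm s p \<in> ?D" if "p \<in> ?D" "s permutes {1..n}" for p s
        using D.inv_op_closed2[of s p] that by (simp add: conj_perm_def sym_group_mult sym_group_carrier)
      have "g \<otimes>\<^bsub>?G\<^esub> inv\<^bsub>?G\<^esub> \<psi> g \<noteq> \<one>\<^bsub>?G\<^esub>"
        using g by (metis auto_closed'(1) inv_closed inv_equality inv_inv)
      then show "g \<otimes>\<^bsub>?G\<^esub> inv\<^bsub>?G\<^esub> \<psi> g \<noteq> id" by (simp only: sym_group_one not_False_eq_True)
    qed (use n in auto)
    have even_D: "p \<in> ?D" if "p permutes {1..n}" "evenperm p" for p
      using that
    proof (induction rule: evenperm_induct)
      case id
      show ?case using D.one_closed by (simp only: sym_group_one)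
    next
      case (comp p q)
      then show ?case using D.m_closed[of p q] by (simp only: sym_group_mult)
    qed (rule three)
    \<comment> \<open>As \<phi> preserves parity, its displacements are even. So f maps A_n, which
      lies in the displacement group, into A_n.\<close>
    have f_D: "f ` ?D \<subseteq> carrier (alt_group n)"
    proof (rule image_displacement_group[OF alt_group_is_subgroup])
      fix g assume g: "g \<in> carrier ?G"
      then have gp: "g permutes {1..n}" by (simp add: sym_group_carrier)
      note \<phi>g = sym_auto_permutes[OF \<phi> gp]
      have "evenperm (inv' (\<phi> g)) \<longleftrightarrow> evenperm (\<phi> g)"
        by (rule evenperm_inv) (use \<phi>g permutes_imp_permutation in blast)
      then have "evenperm (g \<circ> inv' (\<phi> g))"
        using sym_auto_even_iff[OF \<phi> gp] permutes_evenperm_comp[OF _ gp permutes_inv[OF \<phi>g]] by simp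
      moreover have "g \<circ> inv' (\<phi> g) permutes {1..n}"
        using permutes_compose[OF permutes_inv[OF \<phi>g] gp] .
      ultimately show "g \<otimes>\<^bsub>?G\<^esub> inv\<^bsub>?G\<^esub> \<phi> g \<in> carrier (alt_group n)"
        using g by (simp add: alt_group_carrier sym_group_mult)
    qed
    \<comment> \<open>On odd permutations F and f may differ; only the even values of f are used
      from here on.\<close>
    obtain F where F: "F \<in> auto ?G" "\<And>p. p permutes {1..n} \<Longrightarrow> evenperm p \<Longrightarrow> F p = f p"
    proof (rule alternating_auto_extends[OF n, of f])
      show "f (p \<circ> q) = f p \<circ> f q"
        if "p permutes {1..n}" "evenperm p" "q permutes {1..n}" "evenperm q" for p q
        using displacement_group_mult_part even_D[OF that(1,2)] that(3)
        by (auto simp: mult_part_def sym_group_mult sym_group_carrier)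
      show "inj_on f {p. p permutes {1..n} \<and> evenperm p}"
        using bij by (auto simp: bij_betw_def sym_group_carrier intro: inj_on_subset)
      show "f ` {p. p permutes {1..n} \<and> evenperm p} \<subseteq> {p. p permutes {1..n} \<and> evenperm p}"
        using f_D even_D by (auto simp: alt_group_carrier image_subset_iff)
    qed (rule that)
    interpret Aut: group "AutoGroup ?G" by (rule AutoGroup)
    have aut: "compose (carrier ?G) F \<psi> \<in> auto ?G" "compose (carrier ?G) \<phi> F \<in> auto ?G"
      using Aut.m_closed[of F \<psi>] Aut.m_closed[of \<phi> F] F(1) \<psi> \<phi>
      by (simp_all add: auto_group_carrier AutoGroup_mult)
    have "compose (carrier ?G) F \<psi> s = compose (carrier ?G) \<phi> F s" if "s permutes {1..n}" for s
    proof (rule sym_auto_eqI[OF _ aut _ that])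
      fix p assume p: "p permutes {1..n}" "evenperm p"
      then have "F (\<psi> p) = \<phi> (F p)"
        using F(2)[OF sym_auto_permutes[OF \<psi>] sym_auto_even[OF \<psi>]] F(2) f_intertwines[of p]
        by (simp add: sym_group_carrier)
      then show "compose (carrier ?G) F \<psi> p = compose (carrier ?G) \<phi> F p"
        using p by (simp add: compose_def sym_group_carrier)
    qed (use n in simp)
    then show ?thesis
      unfolding auto_conjugate_def using F(1)
      by (intro bexI[of _ F]) (auto simp: compose_def sym_group_carrier)
  qed
qed

section \<open>Three and four points\<close>

lemma conj_permI:
  assumes "s permutes S" "p permutes S" "q permutes S" "\<And>x. x \<in> S \<Longrightarrow> s (p x) = q (s x)"
  shows "conj_perm s p = q"
proof -
  have "s (p x) = q (s x)" for x
    using assms by (cases "x \<in> S") (auto simp: permutes_not_in)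
  then have "s \<circ> p = q \<circ> s" by auto
  then show ?thesis using conj_perm_eq_iff[OF assms(1)] by blast
qed

lemma distinct_length_le_card: "finite S \<Longrightarrow> distinct xs \<Longrightarrow> set xs \<subseteq> S \<Longrightarrow> length xs \<le> card S"
  by (metis card_mono distinct_card)

text \<open>A moved point x outside one orbit of length three would bring in \<open>y x\<close> as a
  fifth point.\<close>

lemma order_three_small_is_three_cycle:
  assumes S: "finite S" "card S \<le> 4" and y: "y permutes S" "y \<circ> y \<circ> y = id" "y \<noteq> id"
  shows "three_cycle S y"
proof -
  obtain a where a: "y a \<noteq> a" using y(3) by fastforce
  have aS: "a \<in> S" using a y(1) by (metis permutes_not_in)
  define b c where "b = y a" and "c = y b"
  have dist: "distinct [a, b, c]" and yc: "y c = a"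
    using order_three_orbit[OF y(2) a] by (simp_all add: b_def c_def)
  have mem: "y x \<in> S \<longleftrightarrow> x \<in> S" for x using permutes_in_image[OF y(1)] .
  have inj: "y v = y w \<longleftrightarrow> v = w" for v w using permutes_inj[OF y(1)] by (simp add: inj_eq)
  have abcS: "{a, b, c} \<subseteq> S" using aS by (simp add: b_def c_def mem)
  have "y x = x" if x: "x \<notin> {a, b, c}" for x
  proof (rule ccontr)
    assume yx: "y x \<noteq> x"
    then have xS: "x \<in> S" using y(1) by (metis permutes_not_in)
    have "y x \<notin> {y a, y b, y c}" using x inj by blast
    then have "distinct [a, b, c, x, y x]"
      using x yx dist yc by (auto simp flip: b_def c_def)
    then show False
      using distinct_length_le_card[OF S(1), of "[a, b, c, x, y x]"] abcS xS S(2) by (simp add: mem)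
  qed
  then have "y = cyc3 a b c"
    using yc by (auto simp: fun_eq_iff cyc3_apply[OF dist] b_def[symmetric] c_def[symmetric])
  then show ?thesis using abcS dist by (simp add: three_cycleI)
qed

text \<open>Not being the transposition of a and \<open>u a\<close>, the involution moves a further
  pair, and the two pairs exhaust S.\<close>

lemma involution_on_four_points:
  assumes S: "finite S" "card S \<le> 4" and u: "u permutes S" "u \<circ> u = id" "u \<noteq> id"
    and no: "\<And>a b. a \<in> S \<Longrightarrow> b \<in> S \<Longrightarrow> a \<noteq> b \<Longrightarrow> u \<noteq> transpose a b"
  obtains a b where "distinct [a, u a, b, u b]" "S = {a, u a, b, u b}"
proof -
  have uu: "u (u x) = x" for x using fun_cong[OF u(2), of x] by simp
  have mem: "u x \<in> S \<longleftrightarrow> x \<in> S" for x using permutes_in_image[OF u(1)] .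
  have moved: "x \<in> S" if "u x \<noteq> x" for x using u(1) that by (metis permutes_not_in)
  obtain a where a: "u a \<noteq> a" using u(3) by fastforce
  have aS: "a \<in> S" "u a \<in> S" using moved[OF a] by (simp_all add: mem)
  then have "u \<noteq> transpose a (u a)" using no[of a "u a"] a by simp
  then obtain b where b: "u b \<noteq> transpose a (u a) b" by (meson ext)
  have dist: "distinct [a, u a, b, u b]"
    using a b uu[of a] uu[of b] by (auto simp: transpose_def split: if_splits)
  have bS: "b \<in> S" "u b \<in> S" using dist moved[of b] by (auto simp: mem)
  have "card {a, u a, b, u b} = 4" using dist by simp
  then have "S = {a, u a, b, u b}"
    using card_seteq[of S "{a, u a, b, u b}"] S aS bS by simp
  then show thesis using that dist by blast
qed

text \<open>Where p x \<noteq> q x, distinct values of p (q x) and q (p x) would give five different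
  points together with x, p x and q x.\<close>

lemma fixed_point_free_involutions_commute:
  assumes S: "finite S" "card S \<le> 4" and p: "p permutes S" "p \<circ> p = id" and q: "q permutes S" "q \<circ> q = id"
    and free: "\<And>x. x \<in> S \<Longrightarrow> p x \<noteq> x" "\<And>x. x \<in> S \<Longrightarrow> q x \<noteq> x"
  shows "p \<circ> q = q \<circ> p"
proof
  fix x
  have pp: "p (p z) = z" and qq: "q (q z) = z" for z
    using fun_cong[OF p(2), of z] fun_cong[OF q(2), of z] by simp_all
  have mem: "p z \<in> S \<longleftrightarrow> z \<in> S" "q z \<in> S \<longleftrightarrow> z \<in> S" for z
    using permutes_in_image[OF p(1)] permutes_in_image[OF q(1)] by auto
  show "(p \<circ> q) x = (q \<circ> p) x"
  proof (cases "x \<in> S \<and> p x \<noteq> q x")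
    case True
    then have x: "x \<in> S" "p x \<noteq> q x" by auto
    have "p (q x) \<noteq> q (p x) \<Longrightarrow> distinct [x, p x, q x, p (q x), q (p x)]"
      using x free(1)[OF x(1)] free(2)[OF x(1)] free(1)[of "q x"] free(2)[of "p x"]
      by (auto simp: mem) (metis pp qq)+
    moreover have "\<not> distinct [x, p x, q x, p (q x), q (p x)]"
      using distinct_length_le_card[OF S(1), of "[x, p x, q x, p (q x), q (p x)]"] x(1) S(2)
      by (auto simp: mem)
    ultimately show ?thesis by auto
  next
    case False
    then show ?thesis
    proof (cases "x \<in> S")
      case True
      then have "p x = q x" using False by blast
      then show ?thesis using pp qq by (metis comp_apply)
    qed (simp add: permutes_not_in[OF p(1)] permutes_not_in[OF q(1)])
  qed
qed

text \<open>A point moved by the square of p starts an orbit of length at least three. Were the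
  length three, at most one point would remain, p would fix it, and the cube of p would be the
  identity.\<close>

lemma four_cycle_on_four_points:
  assumes S: "finite S" "card S \<le> 4" and p: "p permutes S" "p \<circ> p \<noteq> id" "p \<circ> p \<circ> p \<noteq> id"
  obtains a where "distinct [a, p a, p (p a), p (p (p a))]"
    "S = {a, p a, p (p a), p (p (p a))}" "p (p (p (p a))) = a"
proof -
  have inj: "p v = p w \<longleftrightarrow> v = w" for v w using permutes_inj[OF p(1)] by (simp add: inj_eq)
  have mem: "p x \<in> S \<longleftrightarrow> x \<in> S" for x using permutes_in_image[OF p(1)] .
  have fixed: "p x = x" if "x \<notin> S" for x using permutes_not_in[OF p(1) that] .
  obtain a where a: "p (p a) \<noteq> a" using p(2) by fastforce
  then have aS: "a \<in> S" using fixed by metis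
  have d3: "distinct [a, p a, p (p a)]" using a by (auto simp: inj) 
  have "p (p (p a)) \<noteq> a"
  proof
    assume ppp: "p (p (p a)) = a"
    have "p x = x" if x: "x \<notin> {a, p a, p (p a)}" for x
    proof (rule ccontr)
      assume px: "p x \<noteq> x"
      have "p x \<notin> {p (p (p a)), p a, p (p a)}" using x inj by blast
      then have "distinct [a, p a, p (p a), x, p x]" using px x d3 ppp by auto
      moreover have "x \<in> S" using px fixed by blast
      ultimately show False
        using distinct_length_le_card[OF S(1), of "[a, p a, p (p a), x, p x]"] aS S(2)
        by (simp add: mem)
    qed
    then have "p (p (p x)) = x" for x
      using ppp by (metis insertE singletonD)
    then show False using p(3) by (auto simp: fun_eq_iff)
  qed
  then have d4: "distinct [a, p a, p (p a), p (p (p a))]" using d3 by (auto simp: inj)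
  then have "card {a, p a, p (p a), p (p (p a))} = 4" by simp
  then have S_eq: "S = {a, p a, p (p a), p (p (p a))}"
    using card_seteq[of S "{a, p a, p (p a), p (p (p a))}"] S aS by (simp add: mem)
  have "p (p (p (p a))) \<in> S" using aS by (simp add: mem)
  moreover have "p (p (p (p a))) \<notin> {p a, p (p a), p (p (p a))}" using d4 by (auto simp: inj)
  ultimately have "p (p (p (p a))) = a" using S_eq by blast
  then show thesis using that d4 S_eq by blast
qed

text \<open>Transpositions and double transpositions have the same order; they are told apart by the
  commutators with all permutations.\<close>

definition commutators_square_to_id :: "'a set \<Rightarrow> ('a \<Rightarrow> 'a) \<Rightarrow> bool"
  where "commutators_square_to_id S p \<longleftrightarrow>
    (\<forall>g. g permutes S \<longrightarrow> (conj_perm g p \<circ> inv' p) \<circ> (conj_perm g p \<circ> inv' p) = id)"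

text \<open>The commutator of (a b) with (a c) is a three-cycle, whose square is not the
  identity.\<close>

lemma transposition_commutators:
  assumes S: "finite S" "3 \<le> card S" and ab: "a \<in> S" "b \<in> S" "a \<noteq> b"
  shows "\<not> commutators_square_to_id S (transpose a b)"
proof
  assume *: "commutators_square_to_id S (transpose a b)"
  obtain c where c: "c \<in> S" "c \<notin> set [a, b]"
    using card_diff_nonempty[of S "[a, b]"] S card_length[of "[a, b]"] by auto
  have g: "transpose a c permutes S" using ab c by (intro permutes_swap_id)
  have "conj_perm (transpose a c) (transpose a b) = transpose c b"
    using permutes_comp_transpose[OF g, of a b] ab c by (subst conj_perm_eq_iff[OF g]) auto
  moreover have "transpose c b \<circ> transpose a b = cyc3 c b a" by (simp add: cyc3_def transpose_commute)
  ultimately have "cyc3 c b a \<circ> cyc3 c b a = id"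
    using * g unfolding commutators_square_to_id_def by (metis inv_transpose_eq)
  moreover have "distinct [c, b, a]" "distinct [b, c, a]" using ab c by auto
  ultimately show False using cyc3_square cyc3_neq_id by metis
qed

text \<open>A conjugate of p is again an involution without fixed points, so it commutes with p and
  their product squares to the identity.\<close>

lemma double_transposition_commutators:
  assumes S: "finite S" "card S \<le> 4" and p: "p permutes S" "p \<circ> p = id" and free: "\<And>x. x \<in> S \<Longrightarrow> p x \<noteq> x"
  shows "commutators_square_to_id S p"
  unfolding commutators_square_to_id_def
proof (intro allI impI)
  fix g assume g: "g permutes S"
  let ?q = "conj_perm g p"
  have ip: "inv' p = p" using p by (metis inv_unique_comp)
  have q: "?q permutes S" "?q \<circ> ?q = id"
    using conj_perm_permutes[OF g p(1)] conj_perm_comp_right[OF g, of p p] p(2) conj_perm_id[OF g]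
    by auto
  have "?q x \<noteq> x" if "x \<in> S" for x
  proof -
    obtain z where z: "x = g z" using permutes_surj[OF g] by (metis surjD)
    then have "z \<in> S" using that permutes_in_image[OF g] by simp
    then have "g (p z) \<noteq> g z" using free permutes_inj[OF g] by (simp add: inj_eq)
    moreover have "?q (g z) = g (p z)" using fun_cong[OF conj_perm_comp[OF g, of p], of z] by simp
    ultimately show ?thesis using z by simp
  qed
  then have "p \<circ> ?q = ?q \<circ> p"
    using fixed_point_free_involutions_commute[OF S p q free] by blast
  then show "(?q \<circ> inv' p) \<circ> (?q \<circ> inv' p) = id"
    unfolding ip by (metis comp_assoc comp_id p(2) q(2))
qed

text \<open>The cycle types on three or four points are identity, three-cycle, transposition, double
  transposition and four-cycle. The powers separate all but the two kinds of involution, and the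
  commutators separate those. Within one type, matching the cycles entry by entry gives the
  conjugator.\<close>

lemma conjugate_of_invariants_small:
  assumes S: "finite S" "3 \<le> card S" "card S \<le> 4" and p: "p permutes S" and q: "q permutes S"
    and one: "p = id \<longleftrightarrow> q = id"
    and two: "p \<circ> p = id \<longleftrightarrow> q \<circ> q = id"
    and three: "p \<circ> p \<circ> p = id \<longleftrightarrow> q \<circ> q \<circ> q = id"
    and comm: "commutators_square_to_id S p \<longleftrightarrow> commutators_square_to_id S q"
  obtains s where "s permutes S" "conj_perm s p = q"
proof -
  have transp: "(\<exists>a b. a \<in> S \<and> b \<in> S \<and> a \<noteq> b \<and> r = transpose a b) \<longleftrightarrow> \<not> commutators_square_to_id S r"
    if r: "r permutes S" "r \<circ> r = id" "r \<noteq> id" for r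
  proof
    assume no: "\<not> commutators_square_to_id S r"
    show "\<exists>a b. a \<in> S \<and> b \<in> S \<and> a \<noteq> b \<and> r = transpose a b"
    proof (rule ccontr)
      assume "\<not> ?thesis"
      then obtain a b where ab: "distinct [a, r a, b, r b]" "S = {a, r a, b, r b}"
        using involution_on_four_points[OF S(1,3) r] by metis
      have "r (r x) = x" for x using fun_cong[OF r(2), of x] by simp
      then have "r x \<noteq> x" if "x \<in> S" for x using ab that by auto
      then show False using double_transposition_commutators[OF S(1,3) r(1,2)] no by blast
    qed
  qed (use transposition_commutators[OF S(1,2)] in blast)
  consider "p = id" | "p \<noteq> id" "p \<circ> p \<circ> p = id" | "p \<noteq> id" "p \<circ> p = id"
    | "p \<circ> p \<noteq> id" "p \<circ> p \<circ> p \<noteq> id" by auto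
  then show thesis
  proof cases
    case 1
    then show thesis using that[of id] one permutes_id[of S] conj_perm_id by metis
  next
    case 2
    then have "three_cycle S p" "three_cycle S q"
      using order_three_small_is_three_cycle[OF S(1,3)] p q one three by blast+
    then show thesis using three_cycles_conjugate that by metis
  next
    case 3
    then have q3: "q \<noteq> id" "q \<circ> q = id" using one two by auto
    show thesis
    proof (cases "commutators_square_to_id S p")
      case False
      obtain a b where ab: "a \<in> S" "b \<in> S" "a \<noteq> b" "p = transpose a b"
        using transp[OF p 3(2,1)] False by blast
      obtain c d where cd: "c \<in> S" "d \<in> S" "c \<noteq> d" "q = transpose c d"
        using transp[OF q q3(2,1)] False comm by blast
      obtain s where s: "s permutes S" "map s [a, b] = [c, d]"
        using permutes_extend[of "[a, b]" "[c, d]" S] ab cd by auto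
      then have "conj_perm s p = q"
        using permutes_comp_transpose[OF s(1), of a b] ab(4) cd(4)
        by (subst conj_perm_eq_iff[OF s(1)]) auto
      then show thesis using that s(1) by blast
    next
      case True
      have np: "p \<noteq> transpose a b" and nq: "q \<noteq> transpose a b" if "a \<in> S" "b \<in> S" "a \<noteq> b" for a b
        using transp[OF p 3(2,1)] transp[OF q q3(2,1)] True comm that by blast+
      obtain a b where ab: "distinct [a, p a, b, p b]" "S = {a, p a, b, p b}"
        using involution_on_four_points[OF S(1,3) p 3(2,1) np] by metis
      obtain c d where cd: "distinct [c, q c, d, q d]" "S = {c, q c, d, q d}"
        using involution_on_four_points[OF S(1,3) q q3(2,1) nq] by metis
      have pp: "p (p x) = x" and qq: "q (q x) = x" for x
        using fun_cong[OF 3(2), of x] fun_cong[OF q3(2), of x] by simp_all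
      have "set [a, p a, b, p b] \<subseteq> S" "set [c, q c, d, q d] \<subseteq> S" using ab(2) cd(2) by auto
      then obtain s where s: "s permutes S" "map s [a, p a, b, p b] = [c, q c, d, q d]"
        using permutes_extend[OF ab(1) cd(1)] by auto
      have "conj_perm s p = q"
      proof (rule conj_permI[OF s(1) p q])
        fix x assume "x \<in> S"
        then show "s (p x) = q (s x)" using s(2) ab(2) by (auto simp: pp qq)
      qed
      then show thesis using that s(1) by blast
    qed
  next
    case 4
    then have q4: "q \<circ> q \<noteq> id" "q \<circ> q \<circ> q \<noteq> id" using two three by auto
    obtain a where a: "distinct [a, p a, p (p a), p (p (p a))]"
      "S = {a, p a, p (p a), p (p (p a))}" "p (p (p (p a))) = a"
      using four_cycle_on_four_points[OF S(1,3) p 4] .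
    obtain c where c: "distinct [c, q c, q (q c), q (q (q c))]"
      "S = {c, q c, q (q c), q (q (q c))}" "q (q (q (q c))) = c"
      using four_cycle_on_four_points[OF S(1,3) q q4] .
    have "set [a, p a, p (p a), p (p (p a))] \<subseteq> S" "set [c, q c, q (q c), q (q (q c))] \<subseteq> S"
      using a(2) c(2) by auto
    then obtain s where s: "s permutes S"
      "map s [a, p a, p (p a), p (p (p a))] = [c, q c, q (q c), q (q (q c))]"
      using permutes_extend[OF a(1) c(1)] by auto
    have "conj_perm s p = q"
    proof (rule conj_permI[OF s(1) p q])
      fix x assume "x \<in> S"
      then show "s (p x) = q (s x)" using s(2) a(2,3) c(3) by auto
    qed
    then show thesis using that s(1) by blast
  qed
qed

theorem alexander_iso_conjugate_small:
  assumes n: "3 \<le> n" "n \<le> 4" and iso: "pointed_alexander_iso (sym_group n) \<psi> \<phi> f"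
  shows "group.auto_conjugate (sym_group n) \<psi> \<phi>"
proof -
  interpret pointed_alexander_iso "sym_group n" \<psi> \<phi> f by (rule iso)
  let ?G = "sym_group n"
  obtain p where p: "p permutes {1..n}" and \<psi>_eq: "\<psi> = conj_by ?G p"
    using sym_auto_inner[OF n(1) _ \<psi>] n(2) by auto
  obtain q where q: "q permutes {1..n}" and \<phi>_eq: "\<phi> = conj_by ?G q"
    using sym_auto_inner[OF n(1) _ \<phi>] n(2) by auto
  have f_permutes: "f x permutes {1..n}" if "x permutes {1..n}" for x
    using f_closed[of x] that by (simp only: sym_group_carrier)
  have f_inj: "f x = f y \<longleftrightarrow> x = y" if "x permutes {1..n}" "y permutes {1..n}" for x y
    using bij_betw_imp_inj_on[OF bij] that by (auto simp: inj_on_def sym_group_carrier)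
  have f_surj: "\<exists>x. x permutes {1..n} \<and> f x = y" if "y permutes {1..n}" for y
  proof -
    have "y \<in> f ` carrier ?G" using bij_betw_imp_surj_on[OF bij] that by (simp add: sym_group_carrier)
    then show ?thesis by (auto simp: sym_group_carrier)
  qed
  have f_conj: "f (conj_perm p x) = conj_perm q (f x)" if "x permutes {1..n}" for x
    using f_intertwines[of x] that f_permutes[OF that] p q
    by (simp add: \<psi>_eq \<phi>_eq sym_group_conj sym_group_carrier)
  have central: "r = id \<longleftrightarrow> (\<forall>x. x permutes {1..n} \<longrightarrow> conj_perm r x = x)" if r: "r permutes {1..n}" for r
  proof
    assume *: "\<forall>x. x permutes {1..n} \<longrightarrow> conj_perm r x = x"
    have "r \<circ> transpose a b = transpose a b \<circ> r" if "a \<in> {1..n}" "b \<in> {1..n}" for a b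
      using * permutes_swap_id[OF that] conj_perm_eq_iff[OF r] by blast
    then show "r = id"
      using commute_transpositions_imp_id[of "{1..n}" r] r n by simp
  qed (simp add: conj_perm_def)
  \<comment> \<open>A trivial centre lets a permutation be recognized as the identity by its
    conjugation map, and an intertwining bijection preserves triviality of that map. Applied to the
    first three powers of p and q.\<close>
  have transfer: "r = id \<longleftrightarrow> t = id"
    if r: "r permutes {1..n}" and t: "t permutes {1..n}"
      and rt: "\<And>x. x permutes {1..n} \<Longrightarrow> f (conj_perm r x) = conj_perm t (f x)" for r t
  proof -
    have "conj_perm r x = x \<longleftrightarrow> conj_perm t (f x) = f x" if x: "x permutes {1..n}" for x
      using f_inj[OF conj_perm_permutes[OF r x] x] rt[OF x] by simp
    then show ?thesis
      unfolding central[OF r] central[OF t] using f_surj f_permutes by metis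
  qed
  have pp: "p \<circ> p permutes {1..n}" "p \<circ> p \<circ> p permutes {1..n}"
    and qq: "q \<circ> q permutes {1..n}" "q \<circ> q \<circ> q permutes {1..n}"
    using p q by (auto intro: permutes_compose)
  have f_conj2: "f (conj_perm (p \<circ> p) x) = conj_perm (q \<circ> q) (f x)" if "x permutes {1..n}" for x
    using f_conj that conj_perm_permutes[OF p that]
    by (simp add: conj_perm_comp_left[OF p p] conj_perm_comp_left[OF q q])
  have f_conj3: "f (conj_perm (p \<circ> p \<circ> p) x) = conj_perm (q \<circ> q \<circ> q) (f x)" if "x permutes {1..n}" for x
    using f_conj f_conj2 that conj_perm_permutes[OF p that]
    by (simp add: conj_perm_comp_left[OF pp(1) p] conj_perm_comp_left[OF qq(1) q])
  have comm: "commutators_square_to_id {1..n} p \<longleftrightarrow> commutators_square_to_id {1..n} q"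
  proof -
    define d :: "(nat \<Rightarrow> nat) \<Rightarrow> (nat \<Rightarrow> nat) \<Rightarrow> nat \<Rightarrow> nat"
      where "d = (\<lambda>p g. conj_perm g p \<circ> inv' p)"
    \<comment> \<open>For the inner automorphism of r the displacement of g is the commutator of g
      and r; this is why the commutator condition is visible in the quandle.\<close>
    have d: "g \<otimes>\<^bsub>?G\<^esub> inv\<^bsub>?G\<^esub> conj_by ?G r g = d r g" if "r permutes {1..n}" "g permutes {1..n}" for r g
    proof -
      have "inv' (conj_perm r g) = conj_perm r (inv' g)"
        using conj_perm_comp_right[OF that(1), of g "inv' g"] conj_perm_comp_right[OF that(1), of "inv' g" g]
          conj_perm_id[OF that(1)] permutes_inv_o[OF that(2)]
        by (intro inv_unique_comp) auto
      moreover have "g \<circ> conj_perm r (inv' g) = d r g" by (simp add: d_def conj_perm_def comp_assoc)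
      ultimately show ?thesis
        using that conj_perm_permutes[OF that]
        by (simp add: sym_group_conj sym_group_mult sym_group_carrier)
    qed
    have d_permutes: "d r g permutes {1..n}" if "r permutes {1..n}" "g permutes {1..n}" for r g
      unfolding d_def using that by (intro permutes_compose permutes_inv conj_perm_permutes)
    have step: "d p g \<circ> d p g = id \<longleftrightarrow> d q (f g) \<circ> d q (f g) = id" if g: "g permutes {1..n}" for g
    proof -
      \<comment> \<open>Multiplicativity at the displacement itself is enough: f sends its square to
        the square of its image, and f fixes the identity.\<close>
      have "d p g \<in> mult_part"
        using displacement_mult_part[of g] d[OF p g] g by (simp add: \<psi>_eq sym_group_carrier)
      then have "f (d p g \<circ> d p g) = f (d p g) \<circ> f (d p g)"
        using d_permutes[OF p g] by (simp add: mult_part_def sym_group_mult sym_group_carrier)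
      moreover have "f (d p g) = d q (f g)"
        using f_displacement[of g] d[OF p g] d[OF q f_permutes[OF g]] g
        by (simp add: \<psi>_eq \<phi>_eq sym_group_carrier)
      moreover have "f id = id" using f_one by (simp only: sym_group_one)
      ultimately show ?thesis
        using f_inj[OF permutes_compose[OF d_permutes[OF p g] d_permutes[OF p g]] permutes_id] by metis
    qed
    have unfold: "commutators_square_to_id {1..n} r
        \<longleftrightarrow> (\<forall>g. g permutes {1..n} \<longrightarrow> d r g \<circ> d r g = id)" for r
      unfolding commutators_square_to_id_def d_def by (rule refl)
    show ?thesis
      unfolding unfold
    proof (intro iffI allI impI)
      fix g assume all: "\<forall>g. g permutes {1..n} \<longrightarrow> d p g \<circ> d p g = id" and "g permutes {1..n}"
      then obtain h where h: "h permutes {1..n}" "f h = g" using f_surj by blast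
      show "d q g \<circ> d q g = id" using step[OF h(1)] all h by blast
    next
      fix g assume all: "\<forall>g. g permutes {1..n} \<longrightarrow> d q g \<circ> d q g = id" and g: "g permutes {1..n}"
      show "d p g \<circ> d p g = id" using step[OF g] all f_permutes[OF g] by blast
    qed
  qed
  obtain s where s: "s permutes {1..n}" "conj_perm s p = q"
  proof (rule conjugate_of_invariants_small[of "{1..n}" p q])
    show "p = id \<longleftrightarrow> q = id" using transfer[OF p q f_conj] .
    show "p \<circ> p = id \<longleftrightarrow> q \<circ> q = id" using transfer[OF pp(1) qq(1) f_conj2] .
    show "p \<circ> p \<circ> p = id \<longleftrightarrow> q \<circ> q \<circ> q = id" using transfer[OF pp(2) qq(2) f_conj3] .
  qed (use n p q comm that in auto)
  have "s \<circ> p = q \<circ> s" using conj_perm_eq_iff[OF s(1)] s(2) by blast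
  then show ?thesis
    unfolding \<psi>_eq \<phi>_eq using s(1) p q
    by (intro auto_conjugate_conj_by[of p s q]) (simp_all add: sym_group_carrier sym_group_mult)
qed

section \<open>Isomorphic quandles come from conjugate automorphisms\<close>

theorem sym_group_alexander_iso_conjugate:
  assumes n: "3 \<le> n" and \<psi>: "\<psi> \<in> auto (sym_group n)" and \<phi>: "\<phi> \<in> auto (sym_group n)"
    and iso: "gen_alexander (sym_group n) \<psi> \<cong>\<^sub>Q gen_alexander (sym_group n) \<phi>"
  shows "group.auto_conjugate (sym_group n) \<psi> \<phi>"
proof -
  interpret G: group "sym_group n" by (rule sym_group_is_group)
  obtain f where "pointed_alexander_iso (sym_group n) \<psi> \<phi> f"
    using G.gen_alexander_iso_pointed[OF \<psi> \<phi> iso] \<psi> \<phi> sym_group_is_group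
    unfolding pointed_alexander_iso_def pointed_alexander_iso_axioms_def by metis
  then show ?thesis
    using alexander_iso_conjugate_large[of n] alexander_iso_conjugate_small[OF n]
    by (cases "5 \<le> n") auto
qed

theorem theorem5p14:
  shows "(\<forall>n::nat. n \<in> {3..30} - {15} \<longrightarrow>
      (\<exists>F. (\<forall>\<psi>\<in>carrier (AutoGroup (sym_group n)).
              F (conj_class (AutoGroup (sym_group n)) \<psi>) = gen_alexander_class (sym_group n) \<psi>) \<and>
           bij_betw F (conj_classes (AutoGroup (sym_group n)))
             (gen_alexander_classes (sym_group n)))) \<and>
    (\<forall>n::nat. n \<in> {3..30} - {6, 15} \<longrightarrow>
      (\<exists>F. (\<forall>\<pi>\<in>carrier (sym_group n).
              F (conj_class (sym_group n) \<pi>) =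
                gen_alexander_class (sym_group n) (conj_by (sym_group n) \<pi>)) \<and>
           bij_betw F (conj_classes (sym_group n)) (gen_alexander_classes (sym_group n))))"
proof (intro conjI allI impI)
  fix n :: nat assume "n \<in> {3..30} - {15}"
  then have "3 \<le> n" by simp
  then show "\<exists>F. (\<forall>\<psi>\<in>carrier (AutoGroup (sym_group n)).
        F (conj_class (AutoGroup (sym_group n)) \<psi>) = gen_alexander_class (sym_group n) \<psi>) \<and>
      bij_betw F (conj_classes (AutoGroup (sym_group n))) (gen_alexander_classes (sym_group n))"
    by (intro group.AutoGroup_correspondence[OF sym_group_is_group] sym_group_alexander_iso_conjugate)
next
  fix n :: nat assume "n \<in> {3..30} - {6, 15}"
  then have n: "3 \<le> n" "n \<noteq> 6" by simp_all
  show "\<exists>F. (\<forall>\<pi>\<in>carrier (sym_group n).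
        F (conj_class (sym_group n) \<pi>) =
          gen_alexander_class (sym_group n) (conj_by (sym_group n) \<pi>)) \<and>
      bij_betw F (conj_classes (sym_group n)) (gen_alexander_classes (sym_group n))"
  proof (rule group.inner_correspondence[OF sym_group_is_group])
    fix \<psi> assume "\<psi> \<in> auto (sym_group n)"
    then show "\<exists>g\<in>carrier (sym_group n). \<psi> = conj_by (sym_group n) g"
      using sym_auto_inner[OF n] by (metis sym_group_carrier)
  qed (use n in \<open>blast intro: sym_group_centre sym_group_alexander_iso_conjugate\<close>)+
qed

end
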